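(* Let $\xi$ be a real-valued discrete random variable with finite support and $|\xi|_\infty<1$. There exists a fixed constant $C'_\xi$ (independent of $n$) such that, for all $n\ge 1$, \[\mathbb{P}\left[M_n(\xi)\text{ is strongly non-singular}\right]\ge C'_\xi>0.\]
   Context: For a discrete random variable $\xi$, $|\xi|_\infty:=\max_{a\in\mathbb{R}}\mathbb{P}[\xi=a]$. $M_n(\xi)$ denotes an $n\times n$ random matrix whose entries are independent and each distributed as $\xi$. An $n\times n$ matrix is strongly non-singular if its leading $k\times k$ principal minor is non-zero for every $k\in\{1,\dots,n\}$. *)

theory Defs
  imports
    "HOL-Probability.Product_PMF"
    "Jordan_Normal_Form.Determinant"
    "Jordan_Normal_Form.DL_Submatrix"
begin

text \<open>A discrete real random variable is represented by its law, of type \<^typ>\<open>real pmf\<close>;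
  all the notions below depend on the law only.\<close>

text \<open>The quantity $|\xi|_\infty$. The supremum is attained, see \<open>max_atom_attained\<close>.\<close>

definition max_atom :: "real pmf \<Rightarrow> real" where
  "max_atom \<xi> = (SUP a. pmf \<xi> a)"

text \<open>The law of $M_n(\xi)$: the entries, indexed from 0, are independent copies of $\xi$.
  The default value 0 of the product measure is only taken outside the index range, which
  the matrix does not see.\<close>

definition random_matrix :: "nat \<Rightarrow> real pmf \<Rightarrow> real mat pmf" where
  "random_matrix n \<xi> = map_pmf (mat n n) (Pi_pmf ({..<n} \<times> {..<n}) 0 (\<lambda>_. \<xi>))"

definition strongly_nonsingular :: "real mat \<Rightarrow> bool" where
  "strongly_nonsingular A \<longleftrightarrow> square_mat A \<and>
     (\<forall>k\<in>{1..dim_row A}. Determinant.det (submatrix A {..<k} {..<k}) \<noteq> 0)"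

lemma max_atom_attained:
  obtains a where "pmf \<xi> a = max_atom \<xi>" and "\<And>b. pmf \<xi> b \<le> pmf \<xi> a"
proof -
  obtain c where c: "c \<in> set_pmf \<xi>"
    using set_pmf_not_empty[of \<xi>] by blast
  define S where "S = {b. pmf \<xi> c \<le> pmf \<xi> b}"
  have pos: "pmf \<xi> c > 0"
    using c by (simp add: pmf_positive)
  have cS: "c \<in> S"
    by (simp add: S_def)
  have fin: "finite S"
  proof (rule ccontr)
    assume "infinite S"
    obtain m :: nat where m: "1 < real m * pmf \<xi> c"
      using reals_Archimedean3[OF pos] by blast
    obtain T where T: "T \<subseteq> S" "finite T" "card T = m"
      using infinite_arbitrarily_large[OF \<open>infinite S\<close>] by blast
    have "real m * pmf \<xi> c = (\<Sum>b\<in>T. pmf \<xi> c)"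
      using T by simp
    also have "\<dots> \<le> (\<Sum>b\<in>T. pmf \<xi> b)"
      using T by (intro sum_mono) (auto simp: S_def)
    also have "\<dots> = measure_pmf.prob \<xi> T"
      using T by (simp add: measure_measure_pmf_finite)
    also have "\<dots> \<le> 1"
      by simp
    finally show False
      using m by simp
  qed
  have "Max (pmf \<xi> ` S) \<in> pmf \<xi> ` S"
    using fin cS by (intro Max_in) auto
  then obtain a where a: "a \<in> S" "pmf \<xi> a = Max (pmf \<xi> ` S)"
    by force
  have le: "pmf \<xi> b \<le> pmf \<xi> a" for b
  proof (cases "b \<in> S")
    case True
    then show ?thesis
      using fin a by simp
  next
    case False
    then show ?thesis
      using a(1) by (simp add: S_def)
  qed
  have "max_atom \<xi> = pmf \<xi> a"
    unfolding max_atom_def by (rule cSup_eq_maximum) (use le in auto)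
  then show ?thesis
    using that le by simp
qed

lemma submatrix_leading:
  assumes "k \<le> dim_row A" "k \<le> dim_col A"
  shows "submatrix A {..<k} {..<k} = mat k k (\<lambda>ij. A $$ ij)"
proof -
  have pick: "pick {..<k} i = i" if "i < k" for i
  proof -
    have "{a \<in> {..<k}. a < i} = {..<i}"
      using that by auto
    then show ?thesis
      using that pick_card_in_set[of i "{..<k}"] by (metis card_lessThan lessThan_iff)
  qed
  have rc: "{i. i < dim_row A \<and> i \<in> {..<k}} = {..<k}" "{i. i < dim_col A \<and> i \<in> {..<k}} = {..<k}"
    using assms by auto
  show ?thesis
    unfolding submatrix_def rc card_lessThan
    by (rule eq_matI) (simp_all add: pick)
qed

end

theory Submission
  imports
    Defs
    "HOL-Probability.Probability"
    "HOL-Combinatorics.Multiset_Permutations"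
    "HOL-Real_Asymp.Real_Asymp"
begin

text \<open>Let $g_k$ be the probability that the first $k$ leading minors do not vanish. If they do not,
  the first $k$ rows of the next block have a unique null vector $v$ with last coordinate 1, and the
  next minor vanishes iff the last row is orthogonal to $v$.

  If a fixed proportion of the coordinates of $v$ have values of multiplicity at most $k^{2/5}$, the
  last row is orthogonal to $v$ with probability $O(k^{-11/10})$. If $v$ has small support, then the
  last column lies in the span of few columns of the given block, and conditionally on that block
  this has exponentially small probability. Any other $v$ lies in one of relatively few subspaces of
  small dimension, so a union bound makes it superexponentially unlikely; the union bound is applied
  twice, the second time with the concentration that the first one provides. This last probability
  is not conditional on the block, but $g_k$ is at least exponentially small, so altogether
  $g_{k+1} \ge g_k (1 - r_k)$ with $\sum r_k < \infty$.

  The concentration bound compares the row sum, via characteristic functions averaged over a wide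
  Gaussian, with a random walk whose steps are uniform on the coefficients up to sign. For steps
  uniform on $Q$ distinct values this is a Sperner problem in the product of $N$ chains of
  length $Q$, whence the bound $O(1 / (Q \sqrt N))$.\<close>

section \<open>Monotone sums over products of chains\<close>

text \<open>A summable loss needs a bound for the last row beyond k^{-1}, and one union bound cannot
  give it. A vector known only to have linear support has row probability O(k^{-1/2}); this pays for
  fewer than k^{1/2} frequent values, so multiplicities above k^{1/2} remain and the row bound stays
  above k^{-1}. Hence two rounds. The first allows k^{7/20} frequent values, that is multiplicities
  k^{13/20}; the surviving vectors have row bound k^{13/20 - 3/2} = k^{-17/20}. This pays for
  k^{3/5} frequent values in the second round, hence multiplicities k^{2/5} and the final k^{2/5 -
  3/2} = k^{-11/10}. In both rounds a row bound k^{-b} pays for k^a labels if a < 9/10 b, where 9/10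
  reflects that k/10 coordinates may stay unlabelled.

  The Gaussian average dominates the indicator of 0 instead, and its width is sent to infinity only
  after the comparison with the walk, where the limit is a finite count of closed walks.\<close>

lemma central_binomial_upper_bound: "real ((2 * m) choose m) * sqrt (2 * real m + 1) \<le> 4 ^ m"
proof (induction m)
  case (Suc m)
  have central: "real ((2 * k) choose k) = fact (2 * k) / (fact k * fact k)" for k
    using binomial_fact[of k "2 * k", where ?'a = real] by (simp add: mult_2)
  have "real ((2 * Suc m) choose Suc m) = fact (2 * Suc m) / (fact (Suc m) * fact (Suc m))"
    by (rule central)
  also have "(fact (2 * Suc m) :: real) = (2 * (real m + 1)) * (2 * real m + 1) * fact (2 * m)"
    by (simp add: algebra_simps)
  also have "\<dots> / (fact (Suc m) * fact (Suc m))
      = 2 * (2 * real m + 1) / (real m + 1) * (fact (2 * m) / (fact m * fact m))"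
  proof -
    have cancel: "2 * M * a * f / (M * e * (M * e)) = 2 * a / M * (f / (e * e))" if "M \<noteq> 0" for M a e f :: real
      using that by (simp add: divide_simps)
    have "(fact (Suc m) :: real) = (real m + 1) * fact m" by (simp add: add.commute)
    then show ?thesis by (simp only:) (rule cancel, simp)
  qed
  also have "fact (2 * m) / (fact m * fact m) = real ((2 * m) choose m)"
    by (rule central [symmetric])
  finally have eq: "real ((2 * Suc m) choose Suc m)
      = 2 * (2 * real m + 1) / (real m + 1) * real ((2 * m) choose m)" .
  \<comment> \<open>With the ratio just found, the induction step reduces to
    \<open>(2 * m + 1) * (2 * m + 3) <= (2 * m + 2)^2\<close>.\<close>
  have "sqrt (2 * real m + 1) * sqrt (2 * real m + 3) = sqrt ((2 * real m + 1) * (2 * real m + 3))"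
    by (simp add: real_sqrt_mult)
  also have "\<dots> \<le> sqrt ((2 * (real m + 1))\<^sup>2)"
    by (intro real_sqrt_le_mono) (simp add: power2_eq_square algebra_simps)
  finally have le: "sqrt (2 * real m + 1) * sqrt (2 * real m + 3) \<le> 2 * (real m + 1)"
    by simp
  have "real ((2 * Suc m) choose Suc m) * sqrt (2 * real (Suc m) + 1)
      = 2 * real ((2 * m) choose m) * (sqrt (2 * real m + 1))\<^sup>2 * sqrt (2 * real m + 3) / (real m + 1)"
    unfolding eq by (simp add: add.commute)
  also have "\<dots> = 2 * (real ((2 * m) choose m) * sqrt (2 * real m + 1))
      * (sqrt (2 * real m + 1) * sqrt (2 * real m + 3)) / (real m + 1)"
    by (simp add: power2_eq_square)
  also have "\<dots> \<le> 2 * 4 ^ m * (2 * (real m + 1)) / (real m + 1)"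
    by (intro divide_right_mono mult_mono Suc le) auto
  also have "\<dots> = 4 ^ Suc m"
    by (simp add: divide_simps)
  finally show ?case .
qed simp

lemma middle_binomial_upper_bound: "real (n choose (n div 2)) * sqrt (real n + 1) \<le> 2 ^ n"
proof (cases "even n")
  case True
  then obtain m where "n = 2 * m" by blast
  then show ?thesis
    using central_binomial_upper_bound[of m] by (simp add: power_mult)
next
  case False
  then obtain m where n: "n = 2 * m + 1" by (blast elim: oddE)
  \<comment> \<open>By Pascal's rule and symmetry the middle coefficient of an odd row is half the
    central one of the next even row.\<close>
  have "((2 * Suc m) choose Suc m) = 2 * (n choose m)"
    using binomial_symmetric[of m n] by (simp add: n)
  then have "2 * real (n choose m) * sqrt (2 * real m + 3) \<le> 4 ^ Suc m"
    using central_binomial_upper_bound[of "Suc m"] by (simp add: add.commute del: binomial_Suc_Suc)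
  moreover have "sqrt (real n + 1) \<le> sqrt (2 * real m + 3)"
    by (simp add: n)
  ultimately have "2 * real (n choose m) * sqrt (real n + 1) \<le> 4 ^ Suc m"
    by (smt (verit) mult_left_mono of_nat_0_le_iff)
  moreover have "n div 2 = m" "(2::real) ^ n = 2 * 4 ^ m"
    by (simp_all add: n power_mult)
  ultimately show ?thesis by simp
qed

text \<open>\<open>fact j * fact (n - j)\<close> counts the orderings in which a prescribed
  \<open>j\<close>-set precedes its complement. A lower bound that is the same for all
  \<open>j\<close> is the LYM step of the Sperner argument.\<close>

lemma fact_mult_fact_ge:
  assumes "j \<le> n"
  shows "real (fact n) \<le> real (n choose (n div 2)) * (fact j * fact (n - j))"
proof -
  have "real (fact n) = fact j * fact (n - j) * real (n choose j)"
    using binomial_fact_lemma[OF assms] by (metis of_nat_fact of_nat_mult)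
  also have "\<dots> \<le> fact j * fact (n - j) * real (n choose (n div 2))"
    using binomial_maximum[of n j] by (intro mult_left_mono) auto
  finally show ?thesis by (simp add: mult_ac)
qed

text \<open>A path through $[2K]^T$: starting from a point $a$ of $[K]^T$, the coordinates are raised by $K$
  one after the other, in the order of \<open>xs\<close> and in unit steps. The point \<open>(j, r)\<close> of the path has
  $j$ coordinates raised completely and the next one by $r$; so \<open>(j, K)\<close> and \<open>(j + 1, 0)\<close> coincide,
  which accounts for the 2 in \<open>walk_hits_le_2\<close>.\<close>

definition walk_point :: "nat \<Rightarrow> 'a set \<Rightarrow> 'a list \<Rightarrow> ('a \<Rightarrow> nat) \<Rightarrow> nat \<Rightarrow> nat \<Rightarrow> 'a \<Rightarrow> nat" where
  "walk_point K T xs a j r = (\<lambda>t\<in>T. if t \<in> set (take j xs) then a t + K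
     else if t = xs ! j then a t + r else a t)"

lemma walk_hits_le_2:
  fixes F :: "'a \<Rightarrow> nat \<Rightarrow> real"
  assumes fin: "finite T" and xs: "xs \<in> permutations_of_set T" and a: "a \<in> PiE T (\<lambda>_. {..<K})"
    and mono: "\<And>t. t \<in> T \<Longrightarrow> strict_mono_on {..<2 * K} (F t)"
  shows "card {(j, r). j < card T \<and> r \<le> K \<and> (\<Sum>t\<in>T. F t (walk_point K T xs a j r t)) = s} \<le> 2"
proof -
  define N where "N = card T"
  have len: "length xs = N" and set: "set xs = T" and dist: "distinct xs"
    using xs fin by (auto simp: N_def permutations_of_set_def distinct_card)
  define g where "g = (\<lambda>j r. \<Sum>t\<in>T. F t (walk_point K T xs a j r t))"
  have aK: "a t < K" if "t \<in> T" for t using a that by auto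
  have mono_le: "F t x \<le> F t y" if "t \<in> T" "x \<le> y" "y < 2 * K" for t x y
    using strict_mono_on_leD[OF mono[OF that(1)]] that by auto
  have less: "F t x < F t y" if "t \<in> T" "x < y" "y < 2 * K" for t x y
    using strict_mono_onD[OF mono[OF that(1)]] that by auto
  have notin: "xs ! j \<notin> set (take j xs)" if "j < N" for j
    using dist that len by (simp add: in_set_conv_nth nth_eq_iff_index_eq) 
  have in_take: "xs ! j \<in> set (take j' xs)" if "j < j'" "j < N" for j j'
    using that len by (auto simp: in_set_conv_nth intro!: exI[of _ j])
  have sub: "set (take j xs) \<subseteq> set (take j' xs)" if "j \<le> j'" for j j'
    using that by (rule set_take_subset_set_take)
  have g_less: "g j r < g j' r'"
    if "t0 \<in> T" "walk_point K T xs a j r t0 < walk_point K T xs a j' r' t0"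
      and le: "\<And>t. t \<in> T \<Longrightarrow> walk_point K T xs a j r t \<le> walk_point K T xs a j' r' t"
      and "r' \<le> K" "j' < N" for j r j' r' t0
  proof -
    have lt: "walk_point K T xs a j' r' t < 2 * K" if "t \<in> T" for t
      using aK[OF that] that \<open>r' \<le> K\<close> by (auto simp: walk_point_def)
    show ?thesis unfolding g_def
      by (rule sum_strict_mono_ex1[OF fin]) (use that lt mono_le less in blast)+
  qed
  have inner: "g j r < g j r'" if "j < N" "r < r'" "r' \<le> K" for j r r'
    by (rule g_less[of "xs ! j"])
       (use that notin[OF that(1)] len set in \<open>auto simp: walk_point_def\<close>)
  \<comment> \<open>The third hypothesis excludes \<open>r = K\<close> with \<open>r' < K\<close>:
    as \<open>(j, K)\<close> and \<open>(j + 1, 0)\<close> are the same point, strictness fails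
    there.\<close>
  have outer: "g j r < g j' r'" if "j < j'" "j' < N" "r < K \<or> r = K \<and> r' = K" "r' \<le> K" for j r j' r'
  proof (cases "r < K")
    case True
    show ?thesis
      by (rule g_less[of "xs ! j"])
         (use that True notin[of j] in_take[OF that(1)] sub[of j j'] len set in \<open>auto simp: walk_point_def\<close>)
  next
    case False
    have "xs ! j' \<notin> set (take j xs)" "xs ! j' \<noteq> xs ! j" "0 < K"
      using notin[OF that(2)] sub[of j j'] that dist len aK[of "xs ! j'"] set 
      by (auto simp: nth_eq_iff_index_eq)
    then show ?thesis using that False
      by (intro g_less[of "xs ! j'"])
         (use that False notin[of j'] in_take[OF that(1)] sub[of j j'] len set in \<open>auto simp: walk_point_def\<close>)
  qed
  \<comment> \<open>On the indices with \<open>r < K\<close>, and on those with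
    \<open>r = K\<close>, the sum is injective, so each family has at most one hit.\<close>
  let ?H = "\<lambda>R. {(j, r). j < N \<and> r \<in> R \<and> g j r = s}"
  have "card (?H {..<K}) \<le> 1"
  proof -
    have "p = q" if p: "p \<in> ?H {..<K}" and q: "q \<in> ?H {..<K}" for p q
    proof -
      obtain j r j' r' where [simp]: "p = (j, r)" "q = (j', r')" by (cases p; cases q)
      show ?thesis
        using p q inner[of j r r'] inner[of j r' r] outer[of j j' r r'] outer[of j' j r' r]
        by (cases j j' rule: linorder_cases; cases r r' rule: linorder_cases) auto
    qed
    then show ?thesis
      by (metis (no_types, lifting) card_le_Suc0_iff_eq One_nat_def card.infinite le0)
  qed
  moreover have "card (?H {K}) \<le> 1"
  proof -
    have "p = q" if p: "p \<in> ?H {K}" and q: "q \<in> ?H {K}" for p q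
    proof -
      obtain j r j' r' where [simp]: "p = (j, r)" "q = (j', r')" by (cases p; cases q)
      show ?thesis
        using p q outer[of j j' r r'] outer[of j' j r' r]
        by (cases j j' rule: linorder_cases) auto
    qed
    then show ?thesis
      by (metis (no_types, lifting) card_le_Suc0_iff_eq One_nat_def card.infinite le0)
  qed
  moreover have "{(j, r). j < card T \<and> r \<le> K \<and> (\<Sum>t\<in>T. F t (walk_point K T xs a j r t)) = s}
      = ?H {..<K} \<union> ?H {K}"
    by (auto simp: g_def N_def)
  ultimately show ?thesis
    using card_Un_le[of "?H {..<K}" "?H {K}"] by simp
qed


text \<open>The increments with which a path can reach the value $q$ in the coordinate being raised. Values
  near the ends of $[0, 2K)$ have few of them, which is why the counting below is combined with
  an induction on the number of coordinates.\<close>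

definition walk_steps :: "nat \<Rightarrow> nat \<Rightarrow> nat set" where
  "walk_steps K q = {r. r \<le> K \<and> r \<le> q \<and> q < r + K}"

lemma finite_walk_steps [simp]: "finite (walk_steps K q)"
  unfolding walk_steps_def by (rule finite_subset[of _ "{..K}"]) auto

text \<open>The value \<open>q\<close> is reached with \<open>min (q + 1) (2 * K - q)\<close>
  increments, so fewer than \<open>K / 2\<close> occur only within \<open>K / 2\<close> of an end.
  That at most half of the \<open>2 * K\<close> values are lost is what lets the later induction
  close.\<close>

lemma card_few_walk_steps: "card {q. q < 2 * K \<and> 2 * card (walk_steps K q) < K} \<le> K"
proof -
  have ge: "min (q + 1) (2 * K - q) \<le> card (walk_steps K q)" if "q < 2 * K" for q
  proof (cases "q < K")
    case True
    then have "walk_steps K q = {..q}" by (auto simp: walk_steps_def)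
    then show ?thesis by simp
  next
    case False
    then have "walk_steps K q = {q + 1 - K..K}" by (auto simp: walk_steps_def)
    then show ?thesis using False that by simp
  qed
  have "{q. q < 2 * K \<and> 2 * card (walk_steps K q) < K} \<subseteq> {..<K div 2} \<union> {2 * K - K div 2..<2 * K}"
  proof safe
    fix q assume q: "q < 2 * K" "2 * card (walk_steps K q) < K" "q \<notin> {2 * K - K div 2..<2 * K}"
    then show "q < K div 2" using ge[of q] by (auto simp: min_def split: if_splits)
  qed
  then have "card {q. q < 2 * K \<and> 2 * card (walk_steps K q) < K}
      \<le> card ({..<K div 2} \<union> {2 * K - K div 2..<2 * K})"
    by (intro card_mono) auto
  also have "\<dots> \<le> K"
    by (rule order_trans[OF card_Un_le]) simp
  finally show ?thesis .
qed

text \<open>Counts incidences between points of \<open>A\<close> and paths. A path through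
  \<open>x\<close> is given by the coordinate \<open>t0\<close> being raised, its increment, and
  orderings of the coordinates already raised and of those still waiting. As starting points stay
  below \<open>K\<close>, the raised coordinates are those with value at least \<open>K\<close>, and
  the starting point can be recovered. On the right there are
  \<open>fact (card T) * K ^ card T\<close> paths with at most two hits each.\<close>

lemma walk_double_counting:
  fixes F :: "'a \<Rightarrow> nat \<Rightarrow> real" and s :: real
  assumes fin: "finite T" and mono: "\<And>t. t \<in> T \<Longrightarrow> strict_mono_on {..<2 * K} (F t)"
  defines "A \<equiv> {x \<in> PiE T (\<lambda>_. {..<2 * K}). (\<Sum>t\<in>T. F t (x t)) = s}"
  defines "U \<equiv> \<lambda>x t0. {t \<in> T - {t0}. K \<le> x t}"
  shows "(\<Sum>x\<in>A. \<Sum>t0\<in>T. card (walk_steps K (x t0)) * (fact (card (U x t0))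
      * fact (card T - 1 - card (U x t0)))) \<le> 2 * (fact (card T) * K ^ card T)"
proof -
  let ?P = permutations_of_set
  define Big where "Big = (SIGMA x:A. SIGMA t0:T. walk_steps K (x t0) \<times> (?P (U x t0) \<times> ?P (T - {t0} - U x t0)))"
  define Hit where "Hit = (SIGMA p:?P T \<times> PiE T (\<lambda>_. {..<K}). {(j, r). j < card T \<and> r \<le> K \<and>
     (\<Sum>t\<in>T. F t (walk_point K T (fst p) (snd p) j r t)) = s})"
  \<comment> \<open>Undoes the raising: minus the partial increment in \<open>t0\<close>, minus
    \<open>K\<close> wherever the value shows that the coordinate was raised completely.\<close>
  define base where "base = (\<lambda>x t0 r. \<lambda>t\<in>T. if t = t0 then x t - r else if K \<le> x t then x t - K else x t :: nat)"
  define enc where "enc = (\<lambda>(x, t0, r, ys, zs). ((ys @ t0 # zs, base x t0 r), (length ys, r)))"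
  define dec where "dec = (\<lambda>((xs, a), (j, r)). (walk_point K T xs a j r, xs ! j, r, take j xs, drop (Suc j) xs))"
  have finA: "finite A" unfolding A_def
    by (rule finite_subset[of _ "PiE T (\<lambda>_. {..<2 * K})"]) (auto intro!: finite_PiE fin)
  have finU [simp]: "finite (U x t0)" "finite (T - {t0} - U x t0)" for x t0 using fin by (auto simp: U_def)
  have cardU: "card (T - {t0} - U x t0) = card T - 1 - card (U x t0)" if "t0 \<in> T" for x t0
    using that fin by (subst card_Diff_subset) (auto simp: U_def)
  have main: "enc p \<in> Hit \<and> dec (enc p) = p" if "p \<in> Big" for p
  proof -
    obtain x t0 r ys zs where p: "p = (x, t0, r, ys, zs)" by (metis prod.exhaust)
    have x: "x \<in> A" and t0: "t0 \<in> T" and r: "r \<in> walk_steps K (x t0)"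
      and ys: "set ys = U x t0" "distinct ys" and zs: "set zs = T - {t0} - U x t0" "distinct zs"
      using that by (auto simp: Big_def p permutations_of_set_def)
    have x2K: "x t < 2 * K" if "t \<in> T" for t using x that by (auto simp: A_def)
    have wp: "walk_point K T (ys @ t0 # zs) (base x t0 r) (length ys) r = x"
    proof
      fix t show "walk_point K T (ys @ t0 # zs) (base x t0 r) (length ys) r t = x t"
      proof (cases "t \<in> T")
        case True
        have "t \<in> set ys \<longleftrightarrow> t \<noteq> t0 \<and> K \<le> x t" using True ys by (simp add: U_def)
        then show ?thesis using True r t0 by (cases "t = t0") (simp_all add: walk_point_def base_def walk_steps_def)
      next
        case False
        have "x \<in> PiE T (\<lambda>_. {..<2 * K})" using x by (simp add: A_def)
        then have "x t = undefined" using False by (rule PiE_arb)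
        then show ?thesis using False by (simp add: walk_point_def)
      qed
    qed
    have perm: "ys @ t0 # zs \<in> ?P T"
    proof (rule permutations_of_setI)
      have "U x t0 \<subseteq> T" by (auto simp: U_def)
      then show "set (ys @ t0 # zs) = T" using ys zs t0 by auto
      have "t0 \<notin> U x t0" by (simp add: U_def)
      then show "distinct (ys @ t0 # zs)" using ys zs by auto
    qed
    have len: "length ys < card T"
    proof -
      have "length ys = card (U x t0)" using ys by (metis distinct_card)
      also have "\<dots> < card T" using t0 fin by (intro psubset_card_mono) (auto simp: U_def)
      finally show ?thesis .
    qed
    have "base x t0 r \<in> PiE T (\<lambda>_. {..<K})"
    proof (rule PiE_I)
      fix t assume "t \<in> T"
      then show "base x t0 r t \<in> {..<K}"
        using x2K[of t] r by (auto simp: base_def walk_steps_def less_diff_conv2)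
    qed (simp add: base_def)
    then show ?thesis
      using perm wp x r len by (simp add: p enc_def dec_def Hit_def A_def walk_steps_def)
  qed
  have finH: "finite {(j, r). j < card T \<and> r \<le> K \<and> Q j r}" for Q
    by (rule finite_subset[of _ "{..<card T} \<times> {..K}"]) auto
  have finP: "finite (?P T \<times> PiE T (\<lambda>_. {..<K}))"
    using fin by (simp add: finite_PiE)
  have "(\<Sum>x\<in>A. \<Sum>t0\<in>T. card (walk_steps K (x t0)) * (fact (card (U x t0))
      * fact (card T - 1 - card (U x t0)))) = card Big"
    unfolding Big_def using finA fin
    by (simp add: card_cartesian_product cardU cong: sum.cong)
  also have "\<dots> \<le> card Hit"
  proof (rule card_inj_on_le)
    show "inj_on enc Big" using main by (intro inj_on_inverseI[of _ dec]) auto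
    show "enc ` Big \<subseteq> Hit" using main by auto
    show "finite Hit" unfolding Hit_def by (intro finite_SigmaI finP finH)
  qed
  also have "\<dots> = (\<Sum>p\<in>?P T \<times> PiE T (\<lambda>_. {..<K}). card {(j, r). j < card T \<and> r \<le> K \<and>
     (\<Sum>t\<in>T. F t (walk_point K T (fst p) (snd p) j r t)) = s})"
    unfolding Hit_def
    by (intro card_SigmaI finP finH ballI)
  also have "\<dots> \<le> (\<Sum>p\<in>?P T \<times> PiE T (\<lambda>_. {..<K}). 2)"
    using walk_hits_le_2[OF fin _ _ mono] by (intro sum_mono) auto
  also have "\<dots> = 2 * (fact (card T) * K ^ card T)"
    using fin by (simp add: card_cartesian_product card_PiE)
  finally show ?thesis .
qed

text \<open>Points at which \<open>t0\<close> has few increments are counted by fixing that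
  coordinate and induction, the others by \<open>walk_double_counting\<close>. The first kind uses
  at most half of the values of one coordinate, while passing from \<open>N\<close> to
  \<open>N - 1\<close> coordinates worsens the bound by at most \<open>sqrt 2\<close>; the induction
  closes because \<open>sqrt 2 / 2 < 1\<close>.\<close>

lemma card_monotone_sum_eq_le:
  fixes F :: "'a \<Rightarrow> nat \<Rightarrow> real"
  assumes "finite T" "T \<noteq> {}" "K > 0" and mono: "\<And>t. t \<in> T \<Longrightarrow> strict_mono_on {..<2 * K} (F t)"
  shows "real (card {x \<in> PiE T (\<lambda>_. {..<2 * K}). (\<Sum>t\<in>T. F t (x t)) = s})
    \<le> 8 * (2 * K) ^ card T / (K * sqrt (card T))"
  using assms(1,2,4)
proof (induction "card T" arbitrary: T s rule: less_induct)
  case less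
  define A where "A = {x \<in> PiE T (\<lambda>_. {..<2 * K}). (\<Sum>t\<in>T. F t (x t)) = s}"
  define N where "N = card T"
  define E where "E = {q. q < 2 * K \<and> 2 * card (walk_steps K q) < K}"
  define b where "b = real ((N - 1) choose ((N - 1) div 2))"
  have finA: "finite A" unfolding A_def
    by (rule finite_subset[of _ "PiE T (\<lambda>_. {..<2 * K})"]) (auto intro!: finite_PiE less)
  have N: "N > 0" using less by (auto simp: N_def card_gt_0_iff)
  have finE: "finite E" unfolding E_def by simp
  show ?case
  proof (cases "N = 1")
    case True
    then obtain t0 where t0: "T = {t0}" by (metis N_def card_1_singletonE)
    have "x = y" if "x \<in> A" "y \<in> A" for x y
    proof -
      have "x t0 = y t0"
        using that strict_mono_on_imp_inj_on[OF less(4)[of t0]]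
        by (auto simp: A_def t0 PiE_mem dest!: inj_onD)
      then show ?thesis using that unfolding A_def t0 by (intro PiE_ext[of x "{t0}" _ y]) auto
    qed
    then have "card A \<le> 1" using finA by (simp add: card_le_Suc0_iff_eq)
    then show ?thesis using True \<open>K > 0\<close> by (simp add: A_def N_def)
  next
    case N1: False
    define M where "M = 8 * (2 * K) ^ (N - 1) / (K * sqrt (real N - 1))"
    have M0: "M \<ge> 0" using N N1 by (simp add: M_def)
    have edge: "real (card {x \<in> A. x t0 \<in> E}) \<le> K * M" if t0: "t0 \<in> T" for t0
    proof -
      define R where "R = (\<lambda>q. {x \<in> PiE (T - {t0}) (\<lambda>_. {..<2 * K}). (\<Sum>t\<in>T - {t0}. F t (x t)) = s - F t0 q})"
      have finR: "finite (R q)" for q unfolding R_def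
        by (rule finite_subset[of _ "PiE (T - {t0}) (\<lambda>_. {..<2 * K})"]) (auto intro!: finite_PiE less)
      have cardR: "real (card (R q)) \<le> M" for q
      proof -
        have "card (T - {t0}) = N - 1" using t0 less(2) by (simp add: N_def)
        moreover have "T - {t0} \<noteq> {}" using N1 N calculation by (metis Suc_pred card.empty One_nat_def)
        ultimately show ?thesis
          using less(1)[of "T - {t0}" "s - F t0 q"] less(2-4) N1 N
          by (simp add: R_def M_def N_def of_nat_diff)
      qed
      have "card {x \<in> A. x t0 \<in> E} \<le> card (SIGMA q:E. R q)"
      proof (rule card_inj_on_le[of "\<lambda>x. (x t0, restrict x (T - {t0}))"])
        show "inj_on (\<lambda>x. (x t0, restrict x (T - {t0}))) {x \<in> A. x t0 \<in> E}"
        proof (rule inj_onI)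
          fix x y assume xy: "x \<in> {x \<in> A. x t0 \<in> E}" "y \<in> {x \<in> A. x t0 \<in> E}"
            and eq: "(x t0, restrict x (T - {t0})) = (y t0, restrict y (T - {t0}))"
          have "x t = y t" if "t \<in> T" for t
            using eq that by (cases "t = t0") (auto dest: fun_cong[of _ _ t])
          then show "x = y" using xy by (auto simp: A_def intro: PiE_ext)
        qed
        show "(\<lambda>x. (x t0, restrict x (T - {t0}))) ` {x \<in> A. x t0 \<in> E} \<subseteq> (SIGMA q:E. R q)"
          using t0 less(2) by (auto simp: A_def R_def sum.remove[of T t0] split: if_splits)
        show "finite (SIGMA q:E. R q)" using finE finR by auto
      qed
      also have "card (SIGMA q:E. R q) = (\<Sum>q\<in>E. card (R q))" using finE finR by simp
      finally have "real (card {x \<in> A. x t0 \<in> E}) \<le> (\<Sum>q\<in>E. real (card (R q)))" by (simp flip: of_nat_sum)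
      also have "\<dots> \<le> real (card E) * M" using sum_bounded_above[of E "\<lambda>q. real (card (R q))" M] cardR by auto
      also have "\<dots> \<le> K * M"
        using card_few_walk_steps[of K] M0 by (intro mult_right_mono) (auto simp: E_def)
      finally show ?thesis .
    qed
    have "N * (real (card A) - K * M) * K / 2 * fact (N - 1)
        \<le> (\<Sum>t0\<in>T. \<Sum>x\<in>A. real (card (walk_steps K (x t0)))) * fact (N - 1)"
    proof -
      have "(real (card A) - K * M) * (K / 2) \<le> (\<Sum>x\<in>A. real (card (walk_steps K (x t0))))" if t0: "t0 \<in> T" for t0
      proof -
        have "real (card A) - K * M \<le> real (card {x \<in> A. x t0 \<notin> E})"
        proof -
          have "card A = card {x \<in> A. x t0 \<in> E} + card {x \<in> A. x t0 \<notin> E}"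
            using finA by (subst card_Un_disjoint [symmetric]) (auto intro!: arg_cong[of _ _ card])
          then show ?thesis using edge[OF t0] by simp
        qed
        then have "(real (card A) - K * M) * (K / 2) \<le> (\<Sum>x\<in>{x \<in> A. x t0 \<notin> E}. real K / 2)"
          by (simp add: mult_right_mono)
        also have "\<dots> \<le> (\<Sum>x\<in>{x \<in> A. x t0 \<notin> E}. real (card (walk_steps K (x t0))))"
        proof (rule sum_mono)
          fix x assume x: "x \<in> {x \<in> A. x t0 \<notin> E}"
          then have "x t0 < 2 * K" using t0 by (auto simp: A_def)
          then show "real K / 2 \<le> real (card (walk_steps K (x t0)))" using x by (auto simp: E_def)
        qed
        also have "\<dots> \<le> (\<Sum>x\<in>A. real (card (walk_steps K (x t0))))"
          using finA by (intro sum_mono2) auto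
        finally show ?thesis .
      qed
      from sum_mono[of T "\<lambda>_. (real (card A) - K * M) * (K / 2)", OF this]
      show ?thesis by (simp add: N_def)
    qed
    also have "\<dots> \<le> b * real (2 * (fact N * K ^ N))"
    proof -
      define w where "w = (\<lambda>x t0. card {t \<in> T - {t0}. K \<le> x t})"
      have "(\<Sum>t0\<in>T. \<Sum>x\<in>A. real (card (walk_steps K (x t0)))) * fact (N - 1)
          = (\<Sum>x\<in>A. \<Sum>t0\<in>T. real (card (walk_steps K (x t0))) * fact (N - 1))"
        by (subst sum.swap) (simp add: sum_distrib_right)
      also have "\<dots> \<le> (\<Sum>x\<in>A. \<Sum>t0\<in>T. real (card (walk_steps K (x t0)))
          * (b * (fact (w x t0) * fact (N - 1 - w x t0))))"
      proof (intro sum_mono mult_left_mono)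
        fix x t0 assume "t0 \<in> T"
        have "w x t0 \<le> card (T - {t0})" unfolding w_def using less(2) by (intro card_mono) auto
        also have "\<dots> = N - 1" using \<open>t0 \<in> T\<close> less(2) by (simp add: N_def)
        finally show "fact (N - 1) \<le> b * (fact (w x t0) * fact (N - 1 - w x t0))"
          using fact_mult_fact_ge[of "w x t0" "N - 1"] by (simp add: b_def)
      qed simp
      also have "\<dots> = b * real (\<Sum>x\<in>A. \<Sum>t0\<in>T. card (walk_steps K (x t0)) * (fact (w x t0)
        * fact (N - 1 - w x t0)))"
        by (simp add: sum_distrib_left mult_ac)
      also have "\<dots> \<le> b * real (2 * (fact N * K ^ N))"
        using walk_double_counting[OF less(2,4), where s = s]
        by (intro mult_left_mono of_nat_mono) (auto simp: A_def w_def N_def b_def)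
      finally show ?thesis .
    qed
    finally have main: "N * (real (card A) - K * M) * K / 2 * fact (N - 1) \<le> b * real (2 * (fact N * K ^ N))" .
    have "real (card A) \<le> real K * M + 4 * b * real K ^ N / real K"
    proof -
      have factN: "(fact N :: real) = N * fact (N - 1)" using N by (metis fact_reduce of_nat_fact of_nat_mult)
      have "(real (card A) - K * M) * (N * K / 2 * fact (N - 1)) \<le> (4 * b * real K ^ N / real K) * (N * K / 2 * fact (N - 1))"
        using main \<open>K > 0\<close> by (simp add: factN mult_ac)
      then show ?thesis using N \<open>K > 0\<close> by (subst (asm) mult_le_cancel_right) (auto simp: zero_less_mult_iff)
    qed
    also have "4 * b * real K ^ N / real K \<le> 2 * (2 * K) ^ N / (K * sqrt N)"
    proof -
      have "b * sqrt N \<le> 2 ^ (N - 1)" using middle_binomial_upper_bound[of "N - 1"] N by (simp add: b_def of_nat_diff)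
      then have "2 * (b * sqrt N) \<le> 2 ^ N" using N by (cases N) auto
      then show ?thesis
        using N \<open>K > 0\<close> by (simp add: field_simps power_mult_distrib)
    qed
    also have "K * M + 2 * (2 * K) ^ N / (K * sqrt N) \<le> 8 * (2 * K) ^ N / (K * sqrt N)"
    proof -
      \<comment> \<open>In units of \<open>Z\<close>, induction contributes at most
        \<open>4 * (10 / 7) < 6\<close> and double counting 2, whence the constant 8. The number
        \<open>10 / 7\<close> is a rational bound for \<open>sqrt 2\<close>, enough because
        \<open>N\<close> is at least 2.\<close>
      define Z where "Z = (2 * real K) ^ N / (K * sqrt N)"
      have Z: "Z > 0" using N \<open>K > 0\<close> by (simp add: Z_def)
      have "7 * sqrt N \<le> 10 * sqrt (real N - 1)"
      proof -
        have "sqrt (49 * real N) \<le> sqrt (100 * (real N - 1))" using N N1 by (intro real_sqrt_le_mono) simp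
        moreover have "sqrt 49 = 7" "sqrt 100 = 10" by (rule real_sqrt_unique; simp)+
        ultimately show ?thesis by (simp only: real_sqrt_mult)
      qed
      then have r: "sqrt N / sqrt (real N - 1) \<le> 10 / 7" using N N1 by (simp add: field_simps)
      have "K * M = 4 * Z * (sqrt N / sqrt (real N - 1))"
        using N N1 \<open>K > 0\<close> by (cases N) (auto simp: M_def Z_def field_simps)
      also have "\<dots> \<le> 4 * Z * (10 / 7)" using Z by (intro mult_left_mono r) auto
      finally have "real K * M + 2 * Z \<le> 8 * Z" using Z by simp
      then show ?thesis by (simp add: Z_def)
    qed
    finally show ?thesis by (simp add: A_def N_def)
  qed
qed

section \<open>Comparison with a symmetric random walk\<close>

lemma prob_Pi_pmf_eq_sum:
  fixes p :: "real pmf"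
  assumes J: "finite J" and S: "finite (set_pmf p)"
  shows "measure_pmf.prob (Pi_pmf J 0 (\<lambda>_. p)) {f. Q (restrict f J)}
    = (\<Sum>x\<in>PiE J (\<lambda>_. set_pmf p). of_bool (Q x) * (\<Prod>j\<in>J. pmf p (x j)))"
proof -
  let ?M = "Pi_pmf J 0 (\<lambda>_. p)" and ?D = "PiE_dflt J 0 (\<lambda>_. set_pmf p)"
  have fin: "finite ?D" using J S by auto
  have "measure_pmf.prob ?M {f. Q (restrict f J)} = measure_pmf.prob ?M ({f. Q (restrict f J)} \<inter> ?D)"
    using measure_Int_set_pmf[of ?M "{f. Q (restrict f J)}"] set_Pi_pmf[OF J, of 0 "\<lambda>_. p"] by (simp add: o_def)
  also have "\<dots> = (\<Sum>f\<in>{f. Q (restrict f J)} \<inter> ?D. pmf ?M f)"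
    using fin by (intro measure_measure_pmf_finite) auto
  also have "\<dots> = (\<Sum>f\<in>?D. of_bool (Q (restrict f J)) * pmf ?M f)"
    using fin by (intro sum.mono_neutral_cong_left) auto
  also have "\<dots> = (\<Sum>f\<in>?D. of_bool (Q (restrict f J)) * (\<Prod>j\<in>J. pmf p (restrict f J j)))"
    using J by (intro sum.cong refl) (auto simp: pmf_Pi PiE_dflt_def)
  also have "\<dots> = (\<Sum>x\<in>PiE J (\<lambda>_. set_pmf p). of_bool (Q x) * (\<Prod>j\<in>J. pmf p (x j)))"
    unfolding restrict_PiE_dflt[of J 0, symmetric]
    by (subst sum.reindex) (auto simp: inj_on_def PiE_dflt_def restrict_def fun_eq_iff, metis)
  finally show ?thesis .
qed

lemma integrable_std_normal_bounded:
  fixes f :: "real \<Rightarrow> real"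
  assumes "continuous_on UNIV f" "\<And>x. \<bar>f x\<bar> \<le> B"
  shows "integrable std_normal_distribution f"
proof -
  interpret real_distribution std_normal_distribution by (rule real_dist_normal_dist)
  show ?thesis
    by (rule integrable_const_bound[where B = B])
       (use assms borel_measurable_continuous_onI[OF assms(1)] in auto)
qed

lemma integral_std_normal_cos: "(LINT x|std_normal_distribution. cos (t * x)) = exp (- t\<^sup>2 / 2)"
proof -
  interpret real_distribution std_normal_distribution by (rule real_dist_normal_dist)
  have "(LINT x|std_normal_distribution. cos (t * x)) = Re (CLINT x|std_normal_distribution. iexp (t * x))"
  proof -
    have Re: "cos (t * x) = Re (iexp (t * x))" for x by (simp add: cis_conv_exp [symmetric] del: of_real_mult)
    have "integrable std_normal_distribution (\<lambda>x. iexp (t * x))" by (rule integrable_iexp) auto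
    from integral_Re[OF this] show ?thesis by (simp only: Re)
  qed
  also have "\<dots> = Re (char std_normal_distribution t)" by (simp add: char_def)
  finally show ?thesis by (simp add: char_std_normal_distribution)
qed

lemma norm_char_pmf_le_1:
  fixes p :: "real pmf"
  assumes "finite (set_pmf p)"
  shows "cmod (\<Sum>x\<in>set_pmf p. pmf p x * cis (x * u)) \<le> 1"
proof -
  have "cmod (\<Sum>x\<in>set_pmf p. pmf p x * cis (x * u)) \<le> (\<Sum>x\<in>set_pmf p. pmf p x)"
    by (rule order_trans[OF norm_sum]) (simp add: norm_mult)
  then show ?thesis using assms by (simp add: sum_pmf_eq_1)
qed

text \<open>Symmetrization: the squared modulus is the mean of \<open>cos ((X - X') * u)\<close> for
  independent copies \<open>X\<close> and \<open>X'\<close>. All pairs of values except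
  \<open>(a, b)\<close> and \<open>(b, a)\<close> are discarded, and
  \<open>1 - y <= exp (- y)\<close> is applied.\<close>

lemma norm_char_pmf_le:
  fixes p :: "real pmf"
  assumes fin: "finite (set_pmf p)" and ab: "a \<in> set_pmf p" "b \<in> set_pmf p" "a \<noteq> b"
  shows "cmod (\<Sum>x\<in>set_pmf p. pmf p x * cis (x * u)) \<le> exp (- (pmf p a * pmf p b * (1 - cos ((a - b) * u))))"
proof -
  let ?S = "set_pmf p" and ?c = "\<lambda>x y. pmf p x * pmf p y * (1 - cos ((x - y) * u))"
  have one: "(\<Sum>x\<in>?S. pmf p x) = 1" using fin by (simp add: sum_pmf_eq_1)
  have "(cmod (\<Sum>x\<in>?S. pmf p x * cis (x * u)))\<^sup>2 = (\<Sum>x\<in>?S. \<Sum>y\<in>?S. pmf p x * pmf p y * cos ((x - y) * u))"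
  proof -
    have "complex_of_real ((cmod (\<Sum>x\<in>?S. pmf p x * cis (x * u)))\<^sup>2)
        = (\<Sum>x\<in>?S. pmf p x * cis (x * u)) * cnj (\<Sum>x\<in>?S. pmf p x * cis (x * u))"
      by (rule complex_norm_square)
    also have "\<dots> = (\<Sum>x\<in>?S. \<Sum>y\<in>?S. (pmf p x * pmf p y) * cis ((x - y) * u))"
    proof -
      have "pmf p x * cis (x * u) * cnj (pmf p y * cis (y * u)) = (pmf p x * pmf p y) * cis ((x - y) * u)" for x y
      proof -
        have "cis ((x - y) * u) = cis (x * u) * cnj (cis (y * u))"
          by (simp add: cis_cnj cis_mult left_diff_distrib)
        then show ?thesis by (simp add: mult_ac)
      qed
      then show ?thesis by (simp only: sum_product cnj_sum)
    qed
    finally have "Re (complex_of_real ((cmod (\<Sum>x\<in>?S. pmf p x * cis (x * u)))\<^sup>2))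
        = Re (\<Sum>x\<in>?S. \<Sum>y\<in>?S. (pmf p x * pmf p y) * cis ((x - y) * u))" by simp
    then show ?thesis by simp
  qed
  also have "\<dots> = 1 - (\<Sum>x\<in>?S. \<Sum>y\<in>?S. ?c x y)"
    by (simp add: right_diff_distrib sum_subtractf one flip: sum_distrib_left)
  also have "\<dots> \<le> 1 - 2 * ?c a b"
  proof -
    have "2 * ?c a b = (\<Sum>q\<in>{(a, b), (b, a)}. ?c (fst q) (snd q))"
      using ab cos_minus[of "(a - b) * u"] by (simp add: left_diff_distrib)
    also have "\<dots> \<le> (\<Sum>q\<in>?S \<times> ?S. ?c (fst q) (snd q))"
      using ab fin by (intro sum_mono2) auto
    finally show ?thesis by (simp add: sum.cartesian_product case_prod_unfold)
  qed
  also have "\<dots> \<le> exp (- (2 * ?c a b))"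
    using exp_ge_add_one_self[of "- (2 * ?c a b)"] by simp
  also have "\<dots> = (exp (- ?c a b))\<^sup>2"
    by (simp flip: exp_double)
  finally show ?thesis by (rule power2_le_imp_le) simp
qed

text \<open>Replaces the exponential by a polynomial in the characteristic function, that is, by a walk with
  a fixed number of steps.\<close>

lemma exp_le_power_add_exp:
  fixes y L :: real
  assumes "0 \<le> y" "y \<le> 1" "4 * real h \<le> L"
  shows "exp (- (L * (1 - y))) \<le> y ^ (2 * h) + exp (- (L / 2))"
proof (cases "y \<ge> 1 / 2")
  case True
  have "exp (- (2 * (1 - y))) \<le> y"
  proof -
    have "1 \<le> (1 + 2 * (1 - y)) * y"
      using mult_nonneg_nonneg[of "2 * y - 1" "1 - y"] True assms by (simp add: algebra_simps)
    then have "1 / y \<le> 1 + 2 * (1 - y)" using True by (simp add: field_simps)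
    also have "\<dots> \<le> exp (2 * (1 - y))" by (rule exp_ge_add_one_self)
    finally have "1 \<le> y * exp (2 * (1 - y))" using True by (simp add: pos_divide_le_eq mult.commute)
    then show ?thesis by (simp only: exp_minus inverse_eq_divide pos_divide_le_eq[OF exp_gt_zero])
  qed
  then have "exp (- (2 * (1 - y))) ^ (2 * h) \<le> y ^ (2 * h)" by (intro power_mono) auto
  moreover have "exp (- (L * (1 - y))) \<le> exp (- (2 * (1 - y))) ^ (2 * h)"
  proof -
    have "exp (- (2 * (1 - y))) ^ (2 * h) = exp (- (4 * real h * (1 - y)))"
      by (simp add: exp_of_nat_mult [symmetric] algebra_simps)
    then show ?thesis using mult_right_mono[OF assms(3), of "1 - y"] assms(2) by simp
  qed
  ultimately show ?thesis by (simp add: add_increasing2)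
next
  case False
  have "exp (- (L * (1 - y))) \<le> exp (- (L / 2))"
    using False assms(3) mult_left_mono[of "1 / 2" "1 - y" L] by simp
  then show ?thesis using assms(1) by (simp add: add_increasing)
qed

text \<open>The indicator of 0 at \<open>z\<close> is at most
  \<open>exp (- (\<sigma> * z)\<^sup>2 / 2)\<close>, the mean of
  \<open>cos (\<sigma> * z * u)\<close> over a standard normal \<open>u\<close>. Averaged over the
  outcomes, the cosine becomes the real part of a product of characteristic functions.\<close>

lemma prob_sum_eq_le_integral:
  fixes p :: "real pmf" and v :: "'i \<Rightarrow> real"
  assumes J: "finite J" and S: "finite (set_pmf p)"
  shows "measure_pmf.prob (Pi_pmf J 0 (\<lambda>_. p)) {f. (\<Sum>j\<in>J. v j * f j) = s}
    \<le> (LINT u|std_normal_distribution. (\<Prod>j\<in>J. cmod (\<Sum>x\<in>set_pmf p. pmf p x * cis (x * (v j * (\<sigma> * u))))))"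
proof -
  interpret real_distribution std_normal_distribution by (rule real_dist_normal_dist)
  let ?X = "PiE J (\<lambda>_. set_pmf p)"
  define w where "w = (\<lambda>x. \<Prod>j\<in>J. pmf p (x j))"
  define z where "z = (\<lambda>x. (\<Sum>j\<in>J. v j * x j) - s)"
  have finX: "finite ?X" using J S by (intro finite_PiE) auto
  have int_cos: "integrable std_normal_distribution (\<lambda>u. cos (t * u))" for t
    by (rule integrable_std_normal_bounded[where B = 1]) (auto intro!: continuous_intros)
  have "measure_pmf.prob (Pi_pmf J 0 (\<lambda>_. p)) {f. (\<Sum>j\<in>J. v j * f j) = s} = (\<Sum>x\<in>?X. of_bool (z x = 0) * w x)"
    using prob_Pi_pmf_eq_sum[OF J S, of "\<lambda>f. (\<Sum>j\<in>J. v j * f j) = s"] by (simp add: z_def w_def)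
  also have "\<dots> \<le> (\<Sum>x\<in>?X. exp (- (\<sigma> * z x)\<^sup>2 / 2) * w x)"
    by (intro sum_mono mult_right_mono) (auto simp: w_def prod_nonneg)
  also have "\<dots> = (\<Sum>x\<in>?X. (LINT u|std_normal_distribution. cos ((\<sigma> * z x) * u)) * w x)"
    by (simp add: integral_std_normal_cos)
  also have "\<dots> = (LINT u|std_normal_distribution. (\<Sum>x\<in>?X. cos ((\<sigma> * z x) * u) * w x))"
    using int_cos by (subst Bochner_Integration.integral_sum) auto
  also have "\<dots> \<le> (LINT u|std_normal_distribution. (\<Prod>j\<in>J. cmod (\<Sum>x\<in>set_pmf p. pmf p x * cis (x * (v j * (\<sigma> * u))))))"
  proof (rule integral_mono)
    show "integrable std_normal_distribution (\<lambda>u. \<Sum>x\<in>?X. cos ((\<sigma> * z x) * u) * w x)"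
      using int_cos by auto
    show "integrable std_normal_distribution (\<lambda>u. \<Prod>j\<in>J. cmod (\<Sum>x\<in>set_pmf p. pmf p x * cis (x * (v j * (\<sigma> * u)))))"
      by (rule integrable_std_normal_bounded[where B = 1])
         (auto intro!: continuous_intros prod_le_1 norm_char_pmf_le_1[OF S] prod_nonneg simp: abs_prod)
    fix u
    have "(\<Sum>x\<in>?X. cos ((\<sigma> * z x) * u) * w x) = Re (\<Sum>x\<in>?X. cis (- s * (\<sigma> * u)) * (\<Prod>j\<in>J. pmf p (x j) * cis (x j * (v j * (\<sigma> * u)))))"
    proof -
      have "cis (\<sigma> * z x * u) * of_real (w x) = cis (- s * (\<sigma> * u)) * (\<Prod>j\<in>J. pmf p (x j) * cis (x j * (v j * (\<sigma> * u))))" for x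
      proof -
        have "(\<Prod>j\<in>J. cis (x j * (v j * (\<sigma> * u)))) = cis (\<Sum>j\<in>J. x j * (v j * (\<sigma> * u)))"
          by (simp add: cis_conv_exp exp_sum J sum_distrib_left)
        then have "cis (- s * (\<sigma> * u)) * (\<Prod>j\<in>J. pmf p (x j) * cis (x j * (v j * (\<sigma> * u))))
            = of_real (w x) * cis (- s * (\<sigma> * u) + (\<Sum>j\<in>J. x j * (v j * (\<sigma> * u))))"
          by (simp add: prod.distrib w_def cis_mult)
        also have "- s * (\<sigma> * u) + (\<Sum>j\<in>J. x j * (v j * (\<sigma> * u))) = \<sigma> * z x * u"
          by (simp add: z_def algebra_simps sum_distrib_left)
        finally show ?thesis by simp
      qed
      note eq = this
      show ?thesis by (simp only: eq [symmetric]) simp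
    qed
    also have "\<dots> \<le> cmod (\<Sum>x\<in>?X. cis (- s * (\<sigma> * u)) * (\<Prod>j\<in>J. pmf p (x j) * cis (x j * (v j * (\<sigma> * u)))))"
      by (rule complex_Re_le_cmod)
    also have "\<dots> = cmod (\<Prod>j\<in>J. \<Sum>x\<in>set_pmf p. pmf p x * cis (x * (v j * (\<sigma> * u))))"
      using J S by (simp add: norm_mult prod_sum_PiE flip: sum_distrib_left)
    also have "\<dots> = (\<Prod>j\<in>J. cmod (\<Sum>x\<in>set_pmf p. pmf p x * cis (x * (v j * (\<sigma> * u)))))"
      by (simp add: prod_norm)
    finally show "(\<Sum>x\<in>?X. cos ((\<sigma> * z x) * u) * w x) \<le> (\<Prod>j\<in>J. cmod (\<Sum>x\<in>set_pmf p. pmf p x * cis (x * (v j * (\<sigma> * u)))))" .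
  qed
  finally show ?thesis .
qed

text \<open>Each factor of the integrand is at most the exponential of a multiple of
  \<open>cos (v j * t) - 1\<close>, so by \<open>dom\<close> the product is governed by
  \<open>\<psi>\<close>, the mean of \<open>cis (d i * t)\<close> over \<open>I\<close>. By
  \<open>exp_le_power_add_exp\<close> a power of the modulus of \<open>\<psi>\<close> takes over,
  which is the transform of a walk; letting the width tend to infinity counts the closed
  walks.\<close>

lemma prob_sum_eq_le_walk:
  fixes p :: "real pmf" and v :: "'i \<Rightarrow> real" and d :: "'w \<Rightarrow> real"
  assumes J: "finite J" and S: "finite (set_pmf p)" and ab: "a \<in> set_pmf p" "b \<in> set_pmf p" "a \<noteq> b"
    and I: "finite I" "I \<noteq> {}"
    and dom: "\<And>t. (\<Sum>i\<in>I. 1 - cos (d i * t)) \<le> 2 * (\<Sum>j\<in>J. 1 - cos (v j * t))"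
    and h: "8 * real h \<le> pmf p a * pmf p b * card I"
  shows "measure_pmf.prob (Pi_pmf J 0 (\<lambda>_. p)) {f. (\<Sum>j\<in>J. v j * f j) = s}
    \<le> card {w \<in> PiE {..<2 * h} (\<lambda>_. I). (\<Sum>t<2 * h. (if t < h then d (w t) else - d (w t))) = 0} / card I ^ (2 * h)
      + exp (- (pmf p a * pmf p b * card I / 4))" (is "?P \<le> card ?Z / _ + _")
proof -
  interpret real_distribution std_normal_distribution by (rule real_dist_normal_dist)
  let ?W = "PiE {..<2 * h} (\<lambda>_. I)"
  define c where "c = pmf p a * pmf p b"
  define L where "L = c * card I / 2"
  define z where "z = (\<lambda>w. \<Sum>t<2 * h. (if t < h then d (w t) else - d (w t)))"
  define \<psi> where "\<psi> = (\<lambda>t. (\<Sum>i\<in>I. cis (d i * t)) / card I)"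
  have c: "c \<ge> 0" by (simp add: c_def)
  have cI: "real (card I) > 0" using I by (simp add: card_gt_0_iff)
  have finW: "finite ?W" using I by (intro finite_PiE) auto
  have \<psi>le: "cmod (\<psi> t) \<le> 1" for t
  proof -
    have "cmod (\<Sum>i\<in>I. cis (d i * t)) \<le> card I" by (rule order_trans[OF norm_sum]) simp
    then show ?thesis using cI by (simp add: \<psi>_def norm_divide)
  qed
  have Re\<psi>: "card I * (1 - cmod (\<psi> t)) \<le> (\<Sum>i\<in>I. 1 - cos (d i * t))" for t
  proof -
    have "(\<Sum>i\<in>I. 1 - cos (d i * t)) = card I * (1 - Re (\<psi> t))"
      using cI by (simp add: \<psi>_def sum_subtractf right_diff_distrib)
    then show ?thesis using complex_Re_le_cmod[of "\<psi> t"] cI by simp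
  qed
  have power: "cmod (\<psi> t) ^ (2 * h) = (\<Sum>w\<in>?W. cos (z w * t)) / card I ^ (2 * h)" for t
  proof -
    \<comment> \<open>\<open>\<psi>\<close> need not be real; its conjugates produce the steps of
      opposite sign in the second half of the walk.\<close>
    have "complex_of_real (cmod (\<psi> t) ^ (2 * h)) = (\<psi> t * cnj (\<psi> t)) ^ h"
      by (simp add: power_mult flip: complex_norm_square)
    also have "\<dots> = (\<Prod>k<2 * h. if k < h then \<psi> t else cnj (\<psi> t))"
    proof -
      have "{..<2 * h} \<inter> {x. x < h} = {..<h}" "{..<2 * h} \<inter> - {x. x < h} = {h..<2 * h}" by auto
      then show ?thesis by (simp add: prod.If_cases power_mult_distrib)
    qed
    also have "\<dots> = (\<Prod>k<2 * h. \<Sum>i\<in>I. cis ((if k < h then d i else - d i) * t) / card I)"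
      by (intro prod.cong refl) (simp add: \<psi>_def sum_divide_distrib cis_cnj)
    also have "\<dots> = (\<Sum>w\<in>?W. \<Prod>k<2 * h. cis ((if k < h then d (w k) else - d (w k)) * t) / card I)"
      using I by (intro prod_sum_PiE) auto
    also have "\<dots> = (\<Sum>w\<in>?W. cis (z w * t)) / card I ^ (2 * h)"
      by (simp add: prod_dividef z_def cis_conv_exp exp_sum sum_distrib_left sum_distrib_right sum_divide_distrib)
    finally have "Re (complex_of_real (cmod (\<psi> t) ^ (2 * h))) = Re ((\<Sum>w\<in>?W. cis (z w * t)) / of_real (card I ^ (2 * h)))"
      by simp
    then show ?thesis by (simp only: Re_divide_of_real Re_complex_of_real Re_sum cis.simps)
  qed
  \<comment> \<open>\<open>n\<close> is the width of the Gaussian. The factor \<open>a - b\<close>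
    is inherited from \<open>norm_char_pmf_le\<close>; being nonzero, it disappears in the
    limit.\<close>
  have bound: "?P \<le> (\<Sum>w\<in>?W. exp (- (real n * (a - b) * z w)\<^sup>2 / 2)) / card I ^ (2 * h) + exp (- (L / 2))" for n :: nat
  proof -
    have int_cos: "integrable std_normal_distribution (\<lambda>u. cos (t * u))" for t
      by (rule integrable_std_normal_bounded[where B = 1]) (auto intro!: continuous_intros)
    have "?P \<le> (LINT u|std_normal_distribution. (\<Prod>j\<in>J. cmod (\<Sum>x\<in>set_pmf p. pmf p x * cis (x * (v j * (real n * u))))))"
      by (rule prob_sum_eq_le_integral[OF J S])
    also have "\<dots> \<le> (LINT u|std_normal_distribution. (\<Sum>w\<in>?W. cos ((real n * (a - b) * z w) * u)) / card I ^ (2 * h) + exp (- (L / 2)))"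
    proof (rule integral_mono)
      show "integrable std_normal_distribution (\<lambda>u. \<Prod>j\<in>J. cmod (\<Sum>x\<in>set_pmf p. pmf p x * cis (x * (v j * (real n * u)))))"
        by (rule integrable_std_normal_bounded[where B = 1])
           (auto intro!: continuous_intros prod_le_1 norm_char_pmf_le_1[OF S] prod_nonneg simp: abs_prod)
      show "integrable std_normal_distribution (\<lambda>u. (\<Sum>w\<in>?W. cos ((real n * (a - b) * z w) * u)) / card I ^ (2 * h) + exp (- (L / 2)))"
        using int_cos by auto
      fix u
      define t where "t = (a - b) * (real n * u)"
      have "(\<Prod>j\<in>J. cmod (\<Sum>x\<in>set_pmf p. pmf p x * cis (x * (v j * (real n * u)))))
          \<le> (\<Prod>j\<in>J. exp (- (c * (1 - cos (v j * t)))))"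
      proof (intro prod_mono conjI norm_ge_zero)
        fix j
        have eq: "(a - b) * (v j * (real n * u)) = v j * t" by (simp add: t_def)
        show "cmod (\<Sum>x\<in>set_pmf p. pmf p x * cis (x * (v j * (real n * u)))) \<le> exp (- (c * (1 - cos (v j * t))))"
          using norm_char_pmf_le[OF S ab, of "v j * (real n * u)"] by (simp only: c_def eq)
      qed
      also have "\<dots> = exp (- (c * (\<Sum>j\<in>J. 1 - cos (v j * t))))"
        using J by (simp add: exp_sum [symmetric] sum_negf sum_distrib_left)
      also have "\<dots> \<le> exp (- (L * (1 - cmod (\<psi> t))))"
      proof -
        have "L * (1 - cmod (\<psi> t)) = c / 2 * (card I * (1 - cmod (\<psi> t)))" by (simp add: L_def)
        also have "\<dots> \<le> c / 2 * (2 * (\<Sum>j\<in>J. 1 - cos (v j * t)))"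
          using c by (intro mult_left_mono order_trans[OF Re\<psi> dom]) auto
        finally show ?thesis by simp
      qed
      also have "\<dots> \<le> cmod (\<psi> t) ^ (2 * h) + exp (- (L / 2))"
        using h \<psi>le by (intro exp_le_power_add_exp) (auto simp: L_def c_def)
      also have "cmod (\<psi> t) ^ (2 * h) = (\<Sum>w\<in>?W. cos ((real n * (a - b) * z w) * u)) / card I ^ (2 * h)"
        unfolding power by (simp add: t_def mult_ac)
      finally show "(\<Prod>j\<in>J. cmod (\<Sum>x\<in>set_pmf p. pmf p x * cis (x * (v j * (real n * u)))))
          \<le> (\<Sum>w\<in>?W. cos ((real n * (a - b) * z w) * u)) / card I ^ (2 * h) + exp (- (L / 2))" .
    qed
    also have "\<dots> = (\<Sum>w\<in>?W. exp (- (real n * (a - b) * z w)\<^sup>2 / 2)) / card I ^ (2 * h) + exp (- (L / 2))"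
      using int_cos prob_space by (simp add: integral_std_normal_cos)
    finally show ?thesis .
  qed
  have "(\<lambda>n. (\<Sum>w\<in>?W. exp (- (real n * (a - b) * z w)\<^sup>2 / 2)) / card I ^ (2 * h) + exp (- (L / 2)))
      \<longlonglongrightarrow> (\<Sum>w\<in>?W. of_bool (z w = 0)) / card I ^ (2 * h) + exp (- (L / 2))"
  proof (intro tendsto_add tendsto_const tendsto_divide tendsto_sum)
    fix w
    show "(\<lambda>n. exp (- (real n * (a - b) * z w)\<^sup>2 / 2)) \<longlonglongrightarrow> of_bool (z w = 0)"
    proof (cases "z w = 0")
      case False
      define k where "k = ((a - b) * z w)\<^sup>2 / 2"
      have k: "k > 0" using False ab by (simp add: k_def)
      have "(\<lambda>n. exp (- (k * (real n)\<^sup>2))) \<longlonglongrightarrow> 0"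
        using k by real_asymp
      then show ?thesis using False by (simp add: k_def power_mult_distrib mult_ac)
    qed simp
  qed (use cI in auto)
  then have "?P \<le> (\<Sum>w\<in>?W. of_bool (z w = 0)) / card I ^ (2 * h) + exp (- (L / 2))"
    by (rule LIMSEQ_le_const) (use bound in blast)
  also have "(\<Sum>w\<in>?W. of_bool (z w = 0) :: real) = card ?Z"
    using finW by (simp add: z_def Int_def sum.If_cases of_bool_def)
  finally show ?thesis by (simp add: L_def c_def)
qed

section \<open>Concentration in terms of multiplicities\<close>

lemma sorted_gap_less:
  fixes xs :: "real list"
  assumes "sorted xs" and mult: "\<And>x. length (filter (\<lambda>y. y = x) xs) \<le> m" and i: "i + m < length xs"
  shows "xs ! i < xs ! (i + m)"
proof (rule ccontr)
  assume "\<not> xs ! i < xs ! (i + m)"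
  then have eq: "xs ! (i + m) \<le> xs ! i" by simp
  have "{i..i + m} \<subseteq> {k. k < length xs \<and> xs ! k = xs ! i}"
  proof
    fix k assume k: "k \<in> {i..i + m}"
    then have "xs ! i \<le> xs ! k" "xs ! k \<le> xs ! (i + m)"
      using i by (auto intro!: sorted_nth_mono[OF assms(1)])
    then show "k \<in> {k. k < length xs \<and> xs ! k = xs ! i}" using eq i k by auto
  qed
  then have "card {i..i + m} \<le> card {k. k < length xs \<and> xs ! k = xs ! i}"
    by (intro card_mono) auto
  also have "\<dots> \<le> m" using mult[of "xs ! i"] by (simp add: length_filter_conv_card)
  finally show False by simp
qed

text \<open>Splits the indices modulo \<open>m\<close>: within a residue class \<open>D\<close>
  strictly increases, so once the residues of all \<open>2 * h\<close> steps are fixed, in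
  \<open>m ^ (2 * h)\<close> ways, the walk is a monotone sum over a product of chains of length
  \<open>2 * K\<close>.\<close>

lemma card_signed_walks_le:
  fixes D :: "nat \<Rightarrow> real" and K m h :: nat
  assumes gap: "\<And>i. i + m < 2 * K * m \<Longrightarrow> D i < D (i + m)" and K: "K > 0" and h: "h > 0"
  shows "real (card {w \<in> PiE {..<2 * h} (\<lambda>_. {..<m} \<times> {..<2 * K}).
      (\<Sum>t<2 * h. if t < h then D (fst (w t) + m * snd (w t)) else - D (fst (w t) + m * snd (w t))) = 0})
    \<le> real m ^ (2 * h) * (8 * (2 * K) ^ (2 * h) / (K * sqrt (2 * h)))" (is "real (card ?Z) \<le> _")
proof -
  let ?T = "{..<2 * h}"
  \<comment> \<open>For steps of negative sign the chain is run backwards, which makes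
    \<open>- D\<close> increasing.\<close>
  define F where "F = (\<lambda>r t q. if t < h then D (r t + m * q) else - D (r t + m * (2 * K - 1 - q)))"
  define flip where "flip = (\<lambda>t q. if t < h then q else 2 * K - 1 - q)"
  define Q where "Q = (\<lambda>r. {q \<in> PiE ?T (\<lambda>_. {..<2 * K}). (\<Sum>t\<in>?T. F r t (q t)) = 0})"
  define enc where "enc = (\<lambda>w :: nat \<Rightarrow> nat \<times> nat. (\<lambda>t\<in>?T. fst (w t), \<lambda>t\<in>?T. flip t (snd (w t))))"
  have finQ: "finite (Q r)" for r unfolding Q_def
    by (rule finite_subset[of _ "PiE ?T (\<lambda>_. {..<2 * K})"]) (auto intro!: finite_PiE)
  have stepD: "D i < D (i + m * k)" if "0 < k" "i + m * k < 2 * K * m" for i k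
    using that
  proof (induction k)
    case (Suc k)
    have "m > 0" using Suc.prems by (cases m) auto
    have "D (i + m * k) < D (i + m * k + m)" using Suc.prems by (intro gap) (simp add: algebra_simps)
    moreover have "k = 0 \<or> D i < D (i + m * k)" using Suc by (cases "k = 0") auto
    ultimately show ?case by (auto simp: algebra_simps)
  qed simp
  have monoD: "D (r + m * q) < D (r + m * q')" if "q < q'" "q' < 2 * K" "r < m" for r q q'
  proof -
    have "r + m * q' < m * (q' + 1)" using that by simp
    also have "\<dots> \<le> m * (2 * K)" using that by (intro mult_le_mono) auto
    finally have "r + m * q' < 2 * K * m" by (simp add: mult_ac)
    moreover obtain e where "e > 0" "q + e = q'" using less_imp_add_positive[OF \<open>q < q'\<close>] by blast
    ultimately show ?thesis using stepD[of e "r + m * q"] by (auto simp: algebra_simps)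
  qed
  have mono: "strict_mono_on {..<2 * K} (F r t)" if "r \<in> PiE ?T (\<lambda>_. {..<m})" "t \<in> ?T" for r t
  proof (rule strict_mono_onI)
    fix x y assume "x \<in> {..<2 * K}" "y \<in> {..<2 * K}" "x < y"
    moreover have "r t < m" using that by auto
    ultimately show "F r t x < F r t y"
      using monoD[of x y "r t"] monoD[of "2 * K - 1 - y" "2 * K - 1 - x" "r t"] by (auto simp: F_def)
  qed
  have "card ?Z \<le> card (SIGMA r:PiE ?T (\<lambda>_. {..<m}). Q r)"
  proof (rule card_inj_on_le[of enc])
    show "inj_on enc ?Z"
    proof (rule inj_onI)
      fix w w' assume w: "w \<in> ?Z" "w' \<in> ?Z" and eq: "enc w = enc w'"
      have "w t = w' t" if t: "t \<in> ?T" for t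
      proof -
        have "fst (w t) = fst (w' t)" "flip t (snd (w t)) = flip t (snd (w' t))"
          using eq t by (auto simp: enc_def dest!: fun_cong[of _ _ t])
        moreover have "w t \<in> {..<m} \<times> {..<2 * K}" "w' t \<in> {..<m} \<times> {..<2 * K}" using w t by auto
        ultimately show ?thesis by (auto simp: flip_def prod_eq_iff split: if_splits)
      qed
      then show "w = w'" using w by (auto intro: PiE_ext)
    qed
    show "enc ` ?Z \<subseteq> (SIGMA r:PiE ?T (\<lambda>_. {..<m}). Q r)"
    proof (rule image_subsetI)
      fix w assume "w \<in> ?Z"
      then have w: "w \<in> PiE ?T (\<lambda>_. {..<m} \<times> {..<2 * K})"
        and sum: "(\<Sum>t<2 * h. if t < h then D (fst (w t) + m * snd (w t)) else - D (fst (w t) + m * snd (w t))) = 0"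
        by auto
      have wt: "fst (w t) < m" "snd (w t) < 2 * K" if "t \<in> ?T" for t using PiE_mem[OF w that] by auto
      have "F (fst (enc w)) t (snd (enc w) t) = (if t < h then D (fst (w t) + m * snd (w t)) else - D (fst (w t) + m * snd (w t)))"
        if t: "t \<in> ?T" for t
        using wt[OF t] t by (auto simp: F_def enc_def flip_def)
      then have "(\<Sum>t\<in>?T. F (fst (enc w)) t (snd (enc w) t)) = 0"
        using sum by simp
      then show "enc w \<in> (SIGMA r:PiE ?T (\<lambda>_. {..<m}). Q r)"
        using wt K by (auto simp: enc_def Q_def flip_def)
    qed
    show "finite (SIGMA r:PiE ?T (\<lambda>_. {..<m}). Q r)" using finQ by (intro finite_SigmaI finite_PiE) auto
  qed
  also have "\<dots> = (\<Sum>r\<in>PiE ?T (\<lambda>_. {..<m}). card (Q r))" using finQ by (intro card_SigmaI finite_PiE) auto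
  finally have "real (card ?Z) \<le> (\<Sum>r\<in>PiE ?T (\<lambda>_. {..<m}). real (card (Q r)))" by (simp flip: of_nat_sum)
  also have "\<dots> \<le> (\<Sum>r\<in>PiE ?T (\<lambda>_. {..<m}). 8 * (2 * K) ^ (2 * h) / (K * sqrt (2 * h)))"
  proof (rule sum_mono)
    fix r assume r: "r \<in> PiE ?T (\<lambda>_. {..<m})"
    have "0 \<in> ?T" using h by simp
    then have "?T \<noteq> {}" by blast
    from card_monotone_sum_eq_le[OF finite_lessThan this K mono[OF r], where s = 0]
    show "real (card (Q r)) \<le> 8 * (2 * K) ^ (2 * h) / (K * sqrt (2 * h))" by (simp add: Q_def)
  qed
  also have "\<dots> = real m ^ (2 * h) * (8 * (2 * K) ^ (2 * h) / (K * sqrt (2 * h)))"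
    by (simp add: card_PiE)
  finally show ?thesis .
qed

text \<open>The walk takes its steps from the sorted list of all \<open>v j\<close> and
  \<open>- v j\<close>. The cosine is even, so the negatives only cost the factor 2 in
  \<open>dom\<close>, and they are essential: if all coefficients equal a nonzero \<open>x\<close>,
  a walk with steps from \<open>x\<close> alone always closes, whereas \<open>x\<close> and
  \<open>- x\<close> together still give \<open>1 / sqrt (card J)\<close>. This is why the
  multiplicities of \<open>x\<close> and \<open>- x\<close> are added in the hypothesis.\<close>

lemma prob_sum_eq_le_multiplicity:
  fixes p :: "real pmf"
  assumes S: "finite (set_pmf p)" and ab: "a \<in> set_pmf p" "b \<in> set_pmf p" "a \<noteq> b"
  shows "\<exists>C>0. \<forall>(J :: 'i set) v m s. finite J \<longrightarrow> 0 < m \<longrightarrow> m \<le> card J \<longrightarrow>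
    (\<forall>x. card {j \<in> J. v j = x} + card {j \<in> J. v j = - x} \<le> m) \<longrightarrow>
    measure_pmf.prob (Pi_pmf J 0 (\<lambda>_. p)) {f. (\<Sum>j\<in>J. v j * f j) = s} \<le> C * m / (card J * sqrt (card J))"
proof -
  define c where "c = pmf p a * pmf p b"
  have c: "c > 0" using ab by (simp add: c_def pmf_positive)
  \<comment> \<open>The three terms serve the count of closed walks, the exponential error, and the
    case \<open>c * n < 8\<close>, in which \<open>h\<close> would be 0 but the claimed bound
    exceeds 1.\<close>
  define C where "C = 16 * sqrt 8 / sqrt c + 32 / c\<^sup>2 + 8 / c * sqrt (8 / c)"
  have C: "C > 0" "C \<ge> 16 * sqrt 8 / sqrt c + 32 / c\<^sup>2" "C \<ge> 8 / c * sqrt (8 / c)"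
    using c by (auto simp: C_def add_pos_pos)
  have "measure_pmf.prob (Pi_pmf J 0 (\<lambda>_. p)) {f. (\<Sum>j\<in>J. v j * f j) = s} \<le> C * m / (card J * sqrt (card J))"
    if J: "finite J" and m: "0 < m" "m \<le> card J"
      and mult: "\<forall>x. card {j \<in> J. v j = x} + card {j \<in> J. v j = - x} \<le> m"
    for J :: "'i set" and v m s
  proof -
    let ?P = "measure_pmf.prob (Pi_pmf J 0 (\<lambda>_. p)) {f. (\<Sum>j\<in>J. v j * f j) = s}"
    define n where "n = card J"
    have n: "n > 0" using m by (simp add: n_def)
    define h where "h = nat \<lfloor>c * n / 8\<rfloor>"
    have h8: "8 * real h \<le> c * n" using c of_nat_floor[of "c * n / 8"] by (simp add: h_def)
    show ?thesis
    proof (cases "c * n < 8")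
      case True
      then have "real n \<le> 8 / c" using c by (simp add: field_simps)
      then have "n * sqrt n \<le> 8 / c * sqrt (8 / c)" using c by (intro mult_mono real_sqrt_le_mono) auto
      also have "\<dots> \<le> C * m" 
      proof -
        have "C * 1 \<le> C * m" using C m by (intro mult_left_mono) auto
        then show ?thesis using C(3) by linarith
      qed
      finally have "1 \<le> C * m / (n * sqrt n)" using n by simp
      then show ?thesis by (simp add: n_def order_trans[OF measure_pmf.prob_le_1])
    next
      case False
      then have "1 \<le> \<lfloor>c * n / 8\<rfloor>" by (simp add: le_floor_iff)
      then have "real h = of_int \<lfloor>c * n / 8\<rfloor>" "h > 0" by (simp_all add: h_def)
      then have hc: "c * n / 16 \<le> real h" and hpos: "h > 0"
        using \<open>1 \<le> \<lfloor>c * n / 8\<rfloor>\<close> floor_correct[of "c * n / 8"] by linarith+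
      obtain js where js: "set js = J" "distinct js" using finite_distinct_list[OF J] by blast
      define xs where "xs = sort (map v js @ map (\<lambda>j. - v j) js)"
      have lenjs: "length js = n" using js distinct_card by (fastforce simp: n_def)
      have len: "length xs = 2 * n" by (simp add: xs_def lenjs)
      have count: "length (filter (\<lambda>y. y = x) xs) \<le> m" for x
      proof -
        have "length (filter P js) = card {j \<in> J. P j}" for P
          using js by (simp add: distinct_length_filter Int_def conj_commute)
        note filter_js = this
        have "mset xs = mset (map v js) + mset (map (\<lambda>j. - v j) js)" by (simp add: xs_def)
        then have "length (filter P xs) = length (filter P (map v js)) + length (filter P (map (\<lambda>j. - v j) js))" for P
          by (metis filter_union_mset mset_filter size_mset size_union)
        then have "length (filter (\<lambda>y. y = x) xs) = card {j \<in> J. v j = x} + card {j \<in> J. - v j = x}"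
          by (simp add: filter_map o_def filter_js)
        also have "{j \<in> J. - v j = x} = {j \<in> J. v j = - x}" by auto
        finally show ?thesis using mult by auto
      qed
      define K where "K = n div m"
      have K: "K > 0" using m by (simp add: K_def n_def div_greater_zero_iff)
      have Km: "K * m \<le> n" by (simp add: K_def)
      have Kn: "n \<le> 2 * (K * m)"
      proof -
        have "n < m * (K + 1)" using m dividend_less_times_div[of m n] by (simp add: K_def)
        also have "\<dots> \<le> m * (2 * K)" using K by (intro mult_le_mono) auto
        finally show ?thesis by (simp add: mult_ac)
      qed
      define I where "I = {..<m} \<times> {..<2 * K}"
      define d where "d = (\<lambda>(r, q). xs ! (r + m * q))"
      have cardI: "card I = 2 * K * m" by (simp add: I_def card_cartesian_product)
      have dom: "(\<Sum>i\<in>I. 1 - cos (d i * t)) \<le> 2 * (\<Sum>j\<in>J. 1 - cos (v j * t))" for t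
      proof -
        define g where "g = (\<lambda>x. 1 - cos (x * t))"
        have "(\<Sum>i\<in>I. g (d i)) = (\<Sum>r<m. \<Sum>q<2 * K. g (xs ! (r + m * q)))"
          by (simp add: I_def d_def sum.cartesian_product case_prod_unfold)
        also have "\<dots> = (\<Sum>q<2 * K. \<Sum>r<m. g (xs ! (r + m * q)))" by (rule sum.swap)
        also have "\<dots> = (\<Sum>k<2 * K * m. g (xs ! k))"
        proof -
          have "(\<Sum>r<m. g (xs ! (r + m * q))) = sum (\<lambda>k. g (xs ! k)) {q * m..<q * m + m}" for q
            using sum.shift_bounds_nat_ivl[of "\<lambda>k. g (xs ! k)" 0 "q * m" m] by (simp add: lessThan_atLeast0 mult.commute add.commute)
          then show ?thesis by (simp add: sum.nat_group)
        qed
        also have "\<dots> \<le> (\<Sum>k<2 * n. g (xs ! k))"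
          using Km by (intro sum_mono2) (auto simp: g_def)
        also have "\<dots> = sum_list (map g xs)" by (simp add: sum_list_sum_nth len lessThan_atLeast0)
        also have "\<dots> = sum_mset (image_mset g (mset xs))" by (simp flip: sum_mset_sum_list)
        also have "\<dots> = sum_list (map (\<lambda>j. g (v j)) js) + sum_list (map (\<lambda>j. g (- v j)) js)"
          by (simp add: xs_def image_mset.compositionality o_def flip: sum_mset_sum_list)
        also have "\<dots> = 2 * (\<Sum>j\<in>J. g (v j))"
          using js by (simp add: g_def sum_list_distinct_conv_sum_set)
        finally show ?thesis by (simp add: g_def)
      qed
      have "?P \<le> card {w \<in> PiE {..<2 * h} (\<lambda>_. I). (\<Sum>t<2 * h. (if t < h then d (w t) else - d (w t))) = 0} / card I ^ (2 * h)
          + exp (- (c * card I / 4))"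
        unfolding c_def
      proof (rule prob_sum_eq_le_walk[OF J S ab _ _ dom])
        have "(0, 0) \<in> I" using K m by (simp add: I_def)
        then show "I \<noteq> {}" by blast
        show "finite I" by (simp add: I_def)
        have "c * n \<le> c * card I" using Kn c by (intro mult_left_mono of_nat_mono) (auto simp: cardI mult_ac)
        then show "8 * real h \<le> pmf p a * pmf p b * card I" using h8 by (simp add: c_def)
      qed
      also have "card {w \<in> PiE {..<2 * h} (\<lambda>_. I). (\<Sum>t<2 * h. (if t < h then d (w t) else - d (w t))) = 0} / card I ^ (2 * h)
          \<le> 8 / (K * sqrt (2 * h))"
      proof -
        have gap: "xs ! i < xs ! (i + m)" if "i + m < 2 * K * m" for i
          using that Km len by (intro sorted_gap_less count) (auto simp: xs_def)
        have "real (card {w \<in> PiE {..<2 * h} (\<lambda>_. I). (\<Sum>t<2 * h. (if t < h then d (w t) else - d (w t))) = 0})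
            \<le> real m ^ (2 * h) * (8 * (2 * K) ^ (2 * h) / (K * sqrt (2 * h)))"
          using card_signed_walks_le[where D = "(!) xs", OF gap K hpos] unfolding I_def d_def case_prod_unfold .
        also have "\<dots> = 8 / (K * sqrt (2 * h)) * card I ^ (2 * h)"
          by (simp add: cardI power_mult_distrib)
        finally show ?thesis using K m by (simp add: cardI divide_le_eq)
      qed
      also have "8 / (K * sqrt (2 * h)) \<le> 16 * sqrt 8 / sqrt c * m / (n * sqrt n)"
      proof -
        have "sqrt (c * n) / sqrt 8 \<le> sqrt (2 * h)"
          using hc by (simp flip: real_sqrt_divide)
        moreover have "real n / (2 * m) \<le> K"
        proof -
          have "real n \<le> 2 * (real K * real m)" using Kn by (metis of_nat_le_iff of_nat_mult of_nat_numeral)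
          then show ?thesis using m by (simp add: field_simps)
        qed
        ultimately have "real n / (2 * m) * (sqrt (c * n) / sqrt 8) \<le> K * sqrt (2 * h)"
          using c by (intro mult_mono) auto
        moreover have "real n / (2 * m) * (sqrt (c * n) / sqrt 8) > 0" using n m c by simp
        ultimately have "8 / (K * sqrt (2 * h)) \<le> 8 / (real n / (2 * m) * (sqrt (c * n) / sqrt 8))"
          using K hpos n m c by (intro divide_left_mono mult_pos_pos) auto
        also have "\<dots> = 16 * sqrt 8 / sqrt c * m / (n * sqrt n)"
          using n m c by (simp add: real_sqrt_mult field_simps)
        finally show ?thesis .
      qed
      also have "exp (- (c * card I / 4)) \<le> 32 / c\<^sup>2 * m / (n * sqrt n)"
      proof -
        have "exp (- (c * card I / 4)) \<le> exp (- (c * n / 4))"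
        proof -
          have "n \<le> card I" using Kn by (simp add: cardI mult.assoc)
          then have "c * n \<le> c * card I" using c by (intro mult_left_mono) auto
          then show ?thesis by simp
        qed
        also have "\<dots> \<le> 1 / ((c * n / 4)\<^sup>2 / 2)"
        proof -
          have x: "0 < c * n / 4" using c n by simp
          then have "(c * n / 4)\<^sup>2 / 2 \<le> exp (c * n / 4)"
            using exp_lower_Taylor_quadratic[of "c * n / 4"] by linarith
          moreover have "0 < (c * n / 4)\<^sup>2 / 2" using c n by simp
          ultimately show ?thesis
            unfolding exp_minus inverse_eq_divide by (intro divide_left_mono mult_pos_pos) auto
        qed
        also have "\<dots> = 32 / c\<^sup>2 * (1 / (n * n))" by (simp add: power2_eq_square)
        also have "\<dots> \<le> 32 / c\<^sup>2 * (m / (n * sqrt n))"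
        proof (intro mult_left_mono frac_le)
          have "sqrt n \<le> sqrt (n * n)" using n by (intro real_sqrt_le_mono) (simp add: mult_le_cancel_left1)
          then show "n * sqrt n \<le> real (n * n)" by (simp add: mult_left_mono)
        qed (use m n c in auto)
        finally show ?thesis by simp
      qed
      finally have "?P \<le> (16 * sqrt 8 / sqrt c + 32 / c\<^sup>2) * (m / (n * sqrt n))"
        by (simp add: algebra_simps)
      also have "\<dots> \<le> C * (m / (n * sqrt n))" using C by (intro mult_right_mono) auto
      finally show ?thesis by (simp add: n_def)
    qed
  qed
  then show ?thesis using C(1) by (intro exI[of _ C]) blast
qed

section \<open>Union bounds for null vectors\<close>

text \<open>A spanning set of rows, phrased through null vectors so that no matrix rank is needed.\<close>

lemma select_rows:
  fixes y :: "'r \<Rightarrow> 'l \<Rightarrow> real"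
  assumes "finite L" "finite R"
  shows "\<exists>R0\<subseteq>R. card R0 \<le> card L \<and>
    (\<forall>u. (\<forall>i\<in>R0. (\<Sum>l\<in>L. y i l * u l) = 0) \<longrightarrow> (\<forall>i\<in>R. (\<Sum>l\<in>L. y i l * u l) = 0))"
  using assms(1)
proof (induction L arbitrary: y rule: finite_induct)
  case empty
  show ?case by (intro exI[of _ "{}"]) auto
next
  case (insert x L)
  show ?case
  proof (cases "\<forall>i\<in>R. y i x = 0")
    case True
    obtain R0 where R0: "R0 \<subseteq> R" "card R0 \<le> card L"
      "\<And>u. (\<forall>i\<in>R0. (\<Sum>l\<in>L. y i l * u l) = 0) \<Longrightarrow> (\<forall>i\<in>R. (\<Sum>l\<in>L. y i l * u l) = 0)"
      using insert.IH[of y] by blast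
    have eq: "(\<Sum>l\<in>insert x L. y i l * u l) = (\<Sum>l\<in>L. y i l * u l)" if "i \<in> R" for i u
      using insert.hyps True that by simp
    show ?thesis
    proof (intro exI[of _ R0] conjI allI impI)
      show "card R0 \<le> card (insert x L)" using R0(2) insert.hyps by simp
      fix u assume "\<forall>i\<in>R0. (\<Sum>l\<in>insert x L. y i l * u l) = 0"
      then have "\<forall>i\<in>R0. (\<Sum>l\<in>L. y i l * u l) = 0" using eq R0(1) by (metis subsetD)
      then show "\<forall>i\<in>R. (\<Sum>l\<in>insert x L. y i l * u l) = 0" using R0(3)[of u] eq by simp
    qed (rule R0(1))
  next
    case False
    then obtain q where q: "q \<in> R" "y q x \<noteq> 0" by blast
    \<comment> \<open>Elimination with pivot row \<open>q\<close> clears column \<open>x\<close>;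
      for \<open>u\<close> orthogonal to row \<open>q\<close> the sums for \<open>y\<close> and
      \<open>y'\<close> agree.\<close>
    define y' where "y' = (\<lambda>i l. y i l - y i x / y q x * y q l)"
    obtain R0 where R0: "R0 \<subseteq> R" "card R0 \<le> card L"
      "\<And>u. (\<forall>i\<in>R0. (\<Sum>l\<in>L. y' i l * u l) = 0) \<Longrightarrow> (\<forall>i\<in>R. (\<Sum>l\<in>L. y' i l * u l) = 0)"
      using insert.IH[of y'] by blast
    have eq: "(\<Sum>l\<in>L. y' i l * u l)
        = (\<Sum>l\<in>insert x L. y i l * u l) - y i x / y q x * (\<Sum>l\<in>insert x L. y q l * u l)" for i u
      using insert.hyps q
      by (simp add: y'_def sum_subtractf sum_distrib_left algebra_simps)
    show ?thesis
    proof (intro exI[of _ "insert q R0"] conjI allI impI)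
      have "finite R0" using R0(1) assms(2) finite_subset by blast
      then show "card (insert q R0) \<le> card (insert x L)"
        using R0(2) insert.hyps by (simp add: card_insert_if)
      fix u assume u: "\<forall>i\<in>insert q R0. (\<Sum>l\<in>insert x L. y i l * u l) = 0"
      then have "\<forall>i\<in>R0. (\<Sum>l\<in>L. y' i l * u l) = 0" unfolding eq by simp
      then have "\<forall>i\<in>R. (\<Sum>l\<in>L. y' i l * u l) = 0" by (rule R0(3))
      then show "\<forall>i\<in>R. (\<Sum>l\<in>insert x L. y i l * u l) = 0" using u unfolding eq by simp
    qed (use R0 q in auto)
  qed
qed

section \<open>Conditioning on part of the independent entries\<close>

abbreviation iid :: "real pmf \<Rightarrow> 'i set \<Rightarrow> ('i \<Rightarrow> real) pmf" where
  "iid \<xi> A \<equiv> Pi_pmf A 0 (\<lambda>_. \<xi>)"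

definition merge_on :: "'i set \<Rightarrow> ('i \<Rightarrow> real) \<Rightarrow> ('i \<Rightarrow> real) \<Rightarrow> 'i \<Rightarrow> real" where
  "merge_on A f g = (\<lambda>x. if x \<in> A then f x else g x)"

lemma merge_on_in [simp]: "x \<in> A \<Longrightarrow> merge_on A f g x = f x"
  and merge_on_notin [simp]: "x \<notin> A \<Longrightarrow> merge_on A f g x = g x"
  by (simp_all add: merge_on_def)

text \<open>Fubini in the form of conditioning: \<open>Q\<close> holds for every \<open>f\<close>
  that leaves the event possible, and then \<open>r\<close> bounds the conditional probability. An
  object chosen from \<open>f\<close> alone may thus be treated as fixed while the entries in
  \<open>B\<close> are drawn.\<close>

lemma prob_iid_Un_le:
  assumes fin: "finite A" "finite B" "A \<inter> B = {}" and r: "r \<ge> 0"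
    and Q: "\<And>f g. E (merge_on A f g) \<Longrightarrow> Q f"
    and le: "\<And>f. Q f \<Longrightarrow> measure_pmf.prob (iid \<xi> B) {g. E (merge_on A f g)} \<le> r"
  shows "measure_pmf.prob (iid \<xi> (A \<union> B)) {f. E f} \<le> measure_pmf.prob (iid \<xi> A) {f. Q f} * r"
proof -
  have merge: "iid \<xi> (A \<union> B) = map_pmf (\<lambda>(f, g). merge_on A f g) (pair_pmf (iid \<xi> A) (iid \<xi> B))"
    using Pi_pmf_union[OF fin, of 0 "\<lambda>_. \<xi>"] by (simp add: merge_on_def case_prod_unfold)
  have "emeasure (iid \<xi> (A \<union> B)) {f. E f}
      = (\<integral>\<^sup>+ f. \<integral>\<^sup>+ g. indicator {f. E f} (merge_on A f g) \<partial>iid \<xi> B \<partial>iid \<xi> A)"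
    unfolding merge
    by (simp add: nn_integral_pair_pmf' case_prod_unfold indicator_def flip: nn_integral_indicator)
  also have "\<dots> \<le> (\<integral>\<^sup>+ f. ennreal r * indicator {f. Q f} f \<partial>iid \<xi> A)"
  proof (rule nn_integral_mono)
    fix f
    have "(\<integral>\<^sup>+ g. indicator {f. E f} (merge_on A f g) \<partial>iid \<xi> B) = emeasure (iid \<xi> B) {g. E (merge_on A f g)}"
    proof -
      have "(indicator {f. E f} (merge_on A f g) :: ennreal) = indicator {g. E (merge_on A f g)} g" for g
        by (simp add: indicator_def)
      then show ?thesis by simp
    qed
    also have "\<dots> \<le> ennreal r * indicator {f. Q f} f"
    proof (cases "Q f")
      case True
      then show ?thesis using le[OF True] by (simp add: measure_pmf.emeasure_eq_measure ennreal_leI)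
    next
      case False
      then have "{g. E (merge_on A f g)} = {}" using Q by blast
      then show ?thesis by simp
    qed
    finally show "(\<integral>\<^sup>+ g. indicator {f. E f} (merge_on A f g) \<partial>iid \<xi> B) \<le> ennreal r * indicator {f. Q f} f" .
  qed
  also have "\<dots> = ennreal (measure_pmf.prob (iid \<xi> A) {f. Q f} * r)"
    using r by (simp add: nn_integral_cmult_indicator measure_pmf.emeasure_eq_measure mult.commute flip: ennreal_mult)
  finally show ?thesis
    using r by (simp add: measure_pmf.emeasure_eq_measure)
qed

lemma prob_iid_subset:
  assumes "finite B" "A \<subseteq> B" and "\<And>f g. (\<And>x. x \<in> A \<Longrightarrow> f x = g x) \<Longrightarrow> E f \<longleftrightarrow> E g"
  shows "measure_pmf.prob (iid \<xi> B) {f. E f} = measure_pmf.prob (iid \<xi> A) {f. E f}"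
proof -
  have "measure_pmf.prob (iid \<xi> A) {f. E f} = measure_pmf.prob (iid \<xi> B) {f. E (\<lambda>x. if x \<in> A then f x else 0)}"
    unfolding Pi_pmf_subset[OF assms(1,2)] by (simp add: vimage_def)
  also have "{f. E (\<lambda>x. if x \<in> A then f x else 0)} = {f. E f}"
    by (intro Collect_cong assms(3)) auto
  finally show ?thesis by simp
qed

lemma prob_iid_point_le:
  assumes "finite B" and "\<And>x. pmf \<xi> x \<le> \<rho>"
  shows "measure_pmf.prob (iid \<xi> B) {g. \<forall>x\<in>B. g x = c x} \<le> \<rho> ^ card B"
proof -
  have "{g. \<forall>x\<in>B. g x = c x} = Pi B (\<lambda>x. {c x})" by (auto simp: Pi_def)
  then have "measure_pmf.prob (iid \<xi> B) {g. \<forall>x\<in>B. g x = c x} = (\<Prod>x\<in>B. pmf \<xi> (c x))"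
    using measure_Pi_pmf_Pi[OF assms(1), of 0 "\<lambda>_. \<xi>" "\<lambda>x. {c x}"] by (simp add: measure_pmf_single)
  also have "\<dots> \<le> (\<Prod>x\<in>B. \<rho>)" by (intro prod_mono) (simp add: assms(2))
  finally show ?thesis by simp
qed

lemma prob_iid_rows_le:
  assumes "finite R" "finite C" and \<rho>: "0 \<le> \<rho>"
    and row: "\<And>i. i \<in> R \<Longrightarrow> measure_pmf.prob (iid \<xi> ({i} \<times> C)) {f. (\<Sum>j\<in>C. f (i, j) * v j) = 0} \<le> \<rho>"
  shows "measure_pmf.prob (iid \<xi> (R \<times> C)) {f. \<forall>i\<in>R. (\<Sum>j\<in>C. f (i, j) * v j) = 0} \<le> \<rho> ^ card R"
  using assms(1) row
proof (induction R rule: finite_induct)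
  case (insert i R)
  have "measure_pmf.prob (iid \<xi> (R \<times> C \<union> {i} \<times> C)) {f. \<forall>i\<in>insert i R. (\<Sum>j\<in>C. f (i, j) * v j) = 0}
      \<le> measure_pmf.prob (iid \<xi> (R \<times> C)) {f. \<forall>i\<in>R. (\<Sum>j\<in>C. f (i, j) * v j) = 0} * \<rho>"
  proof (rule prob_iid_Un_le)
    fix f g :: "'a \<times> 'b \<Rightarrow> real"
    assume E: "\<forall>i\<in>insert i R. (\<Sum>j\<in>C. merge_on (R \<times> C) f g (i, j) * v j) = 0"
    then show "\<forall>i\<in>R. (\<Sum>j\<in>C. f (i, j) * v j) = 0" by simp
  next
    fix f :: "'a \<times> 'b \<Rightarrow> real"
    have "measure_pmf.prob (iid \<xi> ({i} \<times> C)) {g. \<forall>i\<in>insert i R. (\<Sum>j\<in>C. merge_on (R \<times> C) f g (i, j) * v j) = 0}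
        \<le> measure_pmf.prob (iid \<xi> ({i} \<times> C)) {g. (\<Sum>j\<in>C. g (i, j) * v j) = 0}"
      using insert.hyps by (intro measure_pmf.finite_measure_mono) auto
    also have "\<dots> \<le> \<rho>" using insert.prems by simp
    finally show "measure_pmf.prob (iid \<xi> ({i} \<times> C)) {g. \<forall>i\<in>insert i R. (\<Sum>j\<in>C. merge_on (R \<times> C) f g (i, j) * v j) = 0} \<le> \<rho>" .
  qed (use insert.hyps assms(2) \<rho> in auto)
  also have "\<dots> \<le> \<rho> ^ card R * \<rho>"
    using insert \<rho> by (intro mult_right_mono) auto
  also have "\<dots> = \<rho> ^ card (insert i R)" using insert.hyps by simp
  also have "R \<times> C \<union> {i} \<times> C = insert i R \<times> C" by auto
  finally show ?case .
qed simp

text \<open>Grouping the coordinates by frequent value puts \<open>v\<close> into a subspace with at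
  most \<open>D + F\<close> parameters that is given by a labelling alone; the real values are never
  enumerated. On this subspace at most \<open>D + F\<close> rows imply all the others, so a null
  vector chosen from these rows is annihilated by the remaining ones, which are independent of the
  choice. The first two factors count labellings and sets of rows.\<close>

lemma prob_structured_null_vector_le:
  fixes k n m D F :: nat and Q :: "(nat \<Rightarrow> real) \<Rightarrow> bool"
  assumes D: "n div Suc m \<le> D" and \<rho>: "0 \<le> \<rho>" "\<rho> \<le> 1"
    and row: "\<And>v i. Q v \<Longrightarrow> i < k \<Longrightarrow>
      measure_pmf.prob (iid \<xi> ({i} \<times> {..<n})) {f. (\<Sum>j<n. f (i, j) * v j) = 0} \<le> \<rho>"
  shows "measure_pmf.prob (iid \<xi> ({..<k} \<times> {..<n}))
      {f. \<exists>v. Q v \<and> card {j. j < n \<and> card {i. i < n \<and> v i = v j} \<le> m} \<le> F \<and> (\<forall>i<k. (\<Sum>j<n. f (i, j) * v j) = 0)}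
    \<le> (real D + 1) ^ n * 2 ^ k * \<rho> ^ (k - (D + F))"
proof -
  define W where "W = (\<lambda>lb :: nat \<Rightarrow> nat. \<lambda>v :: nat \<Rightarrow> real. \<forall>i<n. \<forall>j<n. lb i = lb j \<longrightarrow> lb i < D \<longrightarrow> v i = v j)"
  define N where "N = (\<lambda>lb R (f :: nat \<times> nat \<Rightarrow> real) v. Q v \<and> W lb v \<and> (\<forall>i\<in>R. (\<Sum>j<n. f (i, j) * v j) = 0))"
  \<comment> \<open>Chosen from the rows in \<open>R\<close> only, whereas the given null vector may
    depend on all rows.\<close>
  define V where "V = (\<lambda>lb R f. SOME v. N lb R f v)"
  define Ev where "Ev = (\<lambda>lb R f. (\<exists>v. N lb R f v) \<and> (\<forall>i\<in>{..<k} - R. (\<Sum>j<n. f (i, j) * V lb R f j) = 0))"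
  define Ix where "Ix = PiE {..<n} (\<lambda>_. {..D}) \<times> {R. R \<subseteq> {..<k} \<and> card R \<le> D + F}"
  have finIx: "finite Ix" unfolding Ix_def by (intro finite_cartesian_product finite_PiE) auto
  have cover: "\<exists>(lb, R)\<in>Ix. Ev lb R f"
    if v: "Q v" "card {j. j < n \<and> card {i. i < n \<and> v i = v j} \<le> m} \<le> F" "\<forall>i<k. (\<Sum>j<n. f (i, j) * v j) = 0" for f v
  proof -
    define cls where "cls = (\<lambda>x. card {i. i < n \<and> v i = x})"
    define Vb where "Vb = {x \<in> v ` {..<n}. m < cls x}"
    have finVb: "finite Vb" by (simp add: Vb_def)
    have "card Vb * Suc m = (\<Sum>x\<in>Vb. Suc m)" by simp
    also have "\<dots> \<le> (\<Sum>x\<in>Vb. cls x)" by (intro sum_mono) (auto simp: Vb_def)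
    also have "\<dots> = card (\<Union>x\<in>Vb. {i. i < n \<and> v i = x})"
      unfolding cls_def using finVb by (subst card_UN_disjoint) auto
    also have "\<dots> \<le> card {..<n}" by (intro card_mono) auto
    finally have "card Vb \<le> n div Suc m" by (simp add: less_eq_div_iff_mult_less_eq)
    then have cardVb: "card Vb \<le> D" using D by simp
    obtain e where e: "bij_betw e Vb {0..<card Vb}" using ex_bij_betw_finite_nat[OF finVb] by blast
    \<comment> \<open>Frequent values get a label below $D$; the label $D$ marks a coordinate left free.\<close>
    define lb where "lb = (\<lambda>j\<in>{..<n}. if m < cls (v j) then e (v j) else D)"
    have eD: "e x < D" if "x \<in> Vb" for x using bij_betwE[OF e] that cardVb by fastforce
    have lbD: "lb j < D \<longleftrightarrow> m < cls (v j)" if "j < n" for j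
      using that eD[of "v j"] by (auto simp: lb_def Vb_def)
    have lb: "lb \<in> PiE {..<n} (\<lambda>_. {..D})"
      using eD by (auto simp: lb_def Vb_def less_imp_le)
    have W: "W lb v"
      unfolding W_def
    proof (intro allI impI)
      fix i j assume ij: "i < n" "j < n" "lb i = lb j" "lb i < D"
      then have "m < cls (v i)" "m < cls (v j)" using lbD[OF ij(1)] lbD[OF ij(2)] by simp_all
      then have "e (v i) = e (v j)" "v i \<in> Vb" "v j \<in> Vb" using ij by (auto simp: lb_def Vb_def)
      then show "v i = v j" using bij_betw_imp_inj_on[OF e] by (auto dest: inj_onD)
    qed
    \<comment> \<open>Names the free parameter behind a coordinate: a label below \<open>D\<close>
      is shared, any other coordinate \<open>j\<close> gets the parameter \<open>D + j\<close> of
      its own.\<close>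
    define \<kappa> where "\<kappa> = (\<lambda>j. if lb j < D then lb j else D + j)"
    define L where "L = \<kappa> ` {..<n}"
    have "L \<subseteq> {..<D} \<union> (+) D ` {j. j < n \<and> cls (v j) \<le> m}"
      using lbD by (auto simp: L_def \<kappa>_def not_less)
    then have "card L \<le> card ({..<D} \<union> (+) D ` {j. j < n \<and> cls (v j) \<le> m})" by (intro card_mono) auto
    also have "\<dots> \<le> D + F"
      using v(2) card_image_le[of "{j. j < n \<and> cls (v j) \<le> m}" "(+) D"]
      by (intro order_trans[OF card_Un_le]) (simp add: cls_def)
    finally have cardL: "card L \<le> D + F" .
    define y where "y = (\<lambda>i l. \<Sum>j\<in>{j \<in> {..<n}. \<kappa> j = l}. f (i, j))"
    have finL: "finite L" by (simp add: L_def)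
    obtain R where R: "R \<subseteq> {..<k}" "card R \<le> card L"
      "\<And>u. (\<forall>i\<in>R. (\<Sum>l\<in>L. y i l * u l) = 0) \<Longrightarrow> (\<forall>i\<in>{..<k}. (\<Sum>l\<in>L. y i l * u l) = 0)"
      using select_rows[OF finL finite_lessThan[of k], of y] by blast
    have collapse: "(\<forall>i<k. (\<Sum>j<n. f (i, j) * w j) = 0)" if w: "W lb w" "\<forall>i\<in>R. (\<Sum>j<n. f (i, j) * w j) = 0" for w
    proof -
      define u where "u = (\<lambda>l. w (SOME j. j < n \<and> \<kappa> j = l))"
      have u: "u (\<kappa> j) = w j" if "j < n" for j
      proof -
        define j' where "j' = (SOME i. i < n \<and> \<kappa> i = \<kappa> j)"
        have "j' < n \<and> \<kappa> j' = \<kappa> j" unfolding j'_def by (rule someI[of _ j]) (simp add: that)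
        then have "j' < n" "\<kappa> j' = \<kappa> j" by simp_all
        moreover have "lb j' = lb j \<Longrightarrow> lb j' < D \<Longrightarrow> w j' = w j"
          using w(1) \<open>j' < n\<close> that unfolding W_def by blast
        ultimately have "w j' = w j"
          by (cases "lb j' < D"; cases "lb j < D") (simp_all add: \<kappa>_def)
        then show ?thesis by (simp add: u_def j'_def)
      qed
      have "(\<Sum>l\<in>L. y i l * u l) = (\<Sum>j<n. f (i, j) * w j)" for i
      proof -
        have "(\<Sum>l\<in>L. y i l * u l) = (\<Sum>l\<in>L. \<Sum>j\<in>{j \<in> {..<n}. \<kappa> j = l}. f (i, j) * w j)"
          unfolding y_def sum_distrib_right using u by (intro sum.cong refl) auto
        also have "\<dots> = (\<Sum>j<n. f (i, j) * w j)"
          by (rule sum.group) (auto simp: L_def)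
        finally show ?thesis .
      qed
      then show ?thesis using R(3)[of u] w(2) by simp
    qed
    have "N lb R f v" using v W R(1) by (auto simp: N_def)
    then have "N lb R f (V lb R f)" unfolding V_def by (rule someI[of "N lb R f"])
    then have "Ev lb R f" using collapse[of "V lb R f"] unfolding Ev_def N_def by blast
    moreover have "(lb, R) \<in> Ix" using lb R cardL by (auto simp: Ix_def)
    ultimately show ?thesis by blast
  qed
  have each: "measure_pmf.prob (iid \<xi> ({..<k} \<times> {..<n})) {f. Ev lb R f} \<le> \<rho> ^ (k - (D + F))"
    if "(lb, R) \<in> Ix" for lb R
  proof -
    have R: "R \<subseteq> {..<k}" "card R \<le> D + F" using that by (auto simp: Ix_def)
    then have finR: "finite R" using finite_subset by blast
    let ?A = "R \<times> {..<n}" and ?B = "({..<k} - R) \<times> {..<n}"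
    have split: "{..<k} \<times> {..<n} = ?A \<union> ?B" using R by auto
    have N_merge: "N lb R (merge_on ?A f g) = N lb R f" for f g
      by (simp add: N_def fun_eq_iff)
    then have V_merge: "V lb R (merge_on ?A f g) = V lb R f" for f g by (simp add: V_def)
    have "measure_pmf.prob (iid \<xi> (?A \<union> ?B)) {f. Ev lb R f}
        \<le> measure_pmf.prob (iid \<xi> ?A) {f. \<exists>v. N lb R f v} * \<rho> ^ card ({..<k} - R)"
    proof (rule prob_iid_Un_le)
      fix f g assume "Ev lb R (merge_on ?A f g)"
      then show "\<exists>v. N lb R f v" by (simp add: Ev_def N_merge)
    next
      fix f assume "\<exists>v. N lb R f v"
      then have NV: "N lb R f (V lb R f)" unfolding V_def by (rule someI_ex)
      have "measure_pmf.prob (iid \<xi> ?B) {g. Ev lb R (merge_on ?A f g)}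
          \<le> measure_pmf.prob (iid \<xi> ?B) {g. \<forall>i\<in>{..<k} - R. (\<Sum>j\<in>{..<n}. g (i, j) * V lb R f j) = 0}"
        by (intro measure_pmf.finite_measure_mono) (auto simp: Ev_def V_merge)
      also have "\<dots> \<le> \<rho> ^ card ({..<k} - R)"
        using NV row[of "V lb R f"] \<rho> by (intro prob_iid_rows_le) (auto simp: N_def)
      finally show "measure_pmf.prob (iid \<xi> ?B) {g. Ev lb R (merge_on ?A f g)} \<le> \<rho> ^ card ({..<k} - R)" .
    qed (use finR \<rho> in auto)
    also have "\<dots> \<le> 1 * \<rho> ^ card ({..<k} - R)"
      using \<rho> by (intro mult_right_mono) auto
    also have "\<dots> \<le> \<rho> ^ (k - (D + F))"
      using \<rho> R finR by (simp add: card_Diff_subset power_decreasing)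
    finally show ?thesis by (simp only: split)
  qed
  have "measure_pmf.prob (iid \<xi> ({..<k} \<times> {..<n}))
      {f. \<exists>v. Q v \<and> card {j. j < n \<and> card {i. i < n \<and> v i = v j} \<le> m} \<le> F \<and> (\<forall>i<k. (\<Sum>j<n. f (i, j) * v j) = 0)}
    \<le> measure_pmf.prob (iid \<xi> ({..<k} \<times> {..<n})) (\<Union>p\<in>Ix. {f. Ev (fst p) (snd p) f})"
  proof (intro measure_pmf.finite_measure_mono subsetI)
    fix f assume "f \<in> {f. \<exists>v. Q v \<and> card {j. j < n \<and> card {i. i < n \<and> v i = v j} \<le> m} \<le> F \<and> (\<forall>i<k. (\<Sum>j<n. f (i, j) * v j) = 0)}"
    then obtain v where "Q v" "card {j. j < n \<and> card {i. i < n \<and> v i = v j} \<le> m} \<le> F" "\<forall>i<k. (\<Sum>j<n. f (i, j) * v j) = 0"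
      by blast
    from cover[OF this] show "f \<in> (\<Union>p\<in>Ix. {f. Ev (fst p) (snd p) f})" by fastforce
  qed simp
  also have "\<dots> \<le> (\<Sum>p\<in>Ix. measure_pmf.prob (iid \<xi> ({..<k} \<times> {..<n})) {f. Ev (fst p) (snd p) f})"
    by (intro measure_pmf.finite_measure_subadditive_finite finIx) auto
  also have "\<dots> \<le> (\<Sum>p\<in>Ix. \<rho> ^ (k - (D + F)))" by (intro sum_mono each) auto
  also have "\<dots> = real (card Ix) * \<rho> ^ (k - (D + F))" by simp
  also have "\<dots> \<le> ((real D + 1) ^ n * 2 ^ k) * \<rho> ^ (k - (D + F))"
  proof (intro mult_right_mono)
    have "card {R. R \<subseteq> {..<k} \<and> card R \<le> D + F} \<le> card (Pow {..<k})" by (intro card_mono) auto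
    then have "card Ix \<le> (D + 1) ^ n * 2 ^ k"
      by (simp add: Ix_def card_cartesian_product card_PiE card_Pow)
    then have "real (card Ix) \<le> real ((D + 1) ^ n * 2 ^ k)" by (rule of_nat_mono)
    then show "real (card Ix) \<le> (real D + 1) ^ n * 2 ^ k" by (simp add: add.commute)
  qed (use \<rho> in simp)
  finally show ?thesis .
qed

text \<open>As \<open>v k = 1\<close>, the last column is a combination of at most \<open>s\<close>
  columns of the block. For a fixed set \<open>I\<close> of columns, at most \<open>card I\<close>
  entries of the last column determine its other entries, each of which is then correct with
  probability at most \<open>\<rho>\<close>. A Chernoff weight replaces binomial estimates in the
  sum over \<open>I\<close>: each term is multiplied by \<open>\<mu> ^ card I / \<mu> ^ s\<close>,
  which is at least 1, and the sum is extended to all \<open>I\<close>.\<close>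

lemma prob_sparse_combination_le:
  fixes k s :: nat
  assumes \<rho>: "\<And>x. pmf \<xi> x \<le> \<rho>" "\<rho> \<le> 1" and \<mu>: "0 < \<mu>" "\<mu> \<le> 1"
    and G: "\<And>f g. (\<And>i j. i < k \<Longrightarrow> j < k \<Longrightarrow> f (i, j) = g (i, j)) \<Longrightarrow> G f \<longleftrightarrow> G g"
  shows "measure_pmf.prob (iid \<xi> ({..<k} \<times> {..<Suc k}))
      {f. G f \<and> (\<exists>v. v k = 1 \<and> card {j. j < k \<and> v j \<noteq> 0} \<le> s \<and> (\<forall>i<k. (\<Sum>j<Suc k. f (i, j) * v j) = 0))}
    \<le> measure_pmf.prob (iid \<xi> ({..<k} \<times> {..<k})) {f. G f} * ((\<rho> + \<mu>) ^ k / \<mu> ^ s)"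
proof -
  let ?A = "{..<k} \<times> {..<k}" and ?B = "{..<k} \<times> {k}"
  define E where "E = (\<lambda>f. G f \<and> (\<exists>v :: nat \<Rightarrow> real. v k = 1 \<and> card {j. j < k \<and> v j \<noteq> 0} \<le> s \<and> (\<forall>i<k. (\<Sum>j<Suc k. f (i, j) * v j) = 0)))"
  have \<rho>0: "0 \<le> \<rho>" using \<rho>(1) pmf_nonneg by (metis order_trans)
  have "measure_pmf.prob (iid \<xi> (?A \<union> ?B)) {f. E f}
      \<le> measure_pmf.prob (iid \<xi> ?A) {f. G f} * ((\<rho> + \<mu>) ^ k / \<mu> ^ s)"
  proof (rule prob_iid_Un_le)
    fix f g assume "E (merge_on ?A f g)"
    then have "G (merge_on ?A f g)" by (simp add: E_def)
    then show "G f" using G[of f "merge_on ?A f g"] by simp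
  next
    fix f assume "G f"
    define Ix where "Ix = {I. I \<subseteq> {..<k} \<and> card I \<le> s}"
    define H where "H = (\<lambda>I (g :: nat \<times> nat \<Rightarrow> real). \<exists>u :: nat \<Rightarrow> real. \<forall>i<k. (\<Sum>j\<in>I. f (i, j) * u j) + g (i, k) = 0)"
    have finIx: "finite Ix" unfolding Ix_def by simp
    have HI: "measure_pmf.prob (iid \<xi> ?B) {g. H I g} \<le> \<rho> ^ (k - card I)" if I: "I \<in> Ix" for I
    proof -
      have finI: "finite I" using I finite_subset unfolding Ix_def by blast
      obtain R where R: "R \<subseteq> {..<k}" "card R \<le> card I"
        "\<And>u. (\<forall>i\<in>R. (\<Sum>l\<in>I. f (i, l) * u l) = 0) \<Longrightarrow> (\<forall>i\<in>{..<k}. (\<Sum>l\<in>I. f (i, l) * u l) = 0)"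
        using select_rows[OF finI finite_lessThan[of k], of "\<lambda>i l. f (i, l)"] by blast
      have finR: "finite R" using R finite_subset by blast
      let ?A' = "R \<times> {k}" and ?B' = "({..<k} - R) \<times> {k}"
      have split: "?B = ?A' \<union> ?B'" using R by auto
      define T where "T = (\<lambda>(g :: nat \<times> nat \<Rightarrow> real) u. \<forall>i\<in>R. (\<Sum>j\<in>I. f (i, j) * u j) + g (i, k) = 0)"
      have "measure_pmf.prob (iid \<xi> (?A' \<union> ?B')) {g. H I g}
          \<le> measure_pmf.prob (iid \<xi> ?A') {g. \<exists>u. T g u} * \<rho> ^ card ?B'"
      proof (rule prob_iid_Un_le)
        fix g g' assume "H I (merge_on ?A' g g')"
        then obtain u where u: "\<forall>i<k. (\<Sum>j\<in>I. f (i, j) * u j) + merge_on ?A' g g' (i, k) = 0"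
          unfolding H_def by blast
        have "T g u" unfolding T_def using u R(1) by fastforce
        then show "\<exists>u. T g u" by blast
      next
        fix g assume "\<exists>u. T g u"
        then obtain u where u: "T g u" by blast
        have "measure_pmf.prob (iid \<xi> ?B') {g'. H I (merge_on ?A' g g')}
            \<le> measure_pmf.prob (iid \<xi> ?B') {g'. \<forall>x\<in>?B'. g' x = - (\<Sum>j\<in>I. f (fst x, j) * u j)}"
        proof (intro measure_pmf.finite_measure_mono subsetI)
          fix g' assume "g' \<in> {g'. H I (merge_on ?A' g g')}"
          then obtain w where w: "\<forall>i<k. (\<Sum>j\<in>I. f (i, j) * w j) + merge_on ?A' g g' (i, k) = 0"
            unfolding H_def by blast
          \<comment> \<open>Two solutions for the same entries in \<open>R\<close> differ by a
            vector that all rows annihilate, so \<open>u\<close> already forces the entries outside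
            \<open>R\<close>.\<close>
          have "(\<Sum>j\<in>I. f (i, j) * (w j - u j)) = 0" if "i \<in> R" for i
          proof -
            have "(\<Sum>j\<in>I. f (i, j) * w j) + g (i, k) = 0" using w R(1) that by fastforce
            moreover have "(\<Sum>j\<in>I. f (i, j) * u j) + g (i, k) = 0" using u that unfolding T_def by blast
            ultimately show ?thesis by (simp add: right_diff_distrib sum_subtractf)
          qed
          then have "\<forall>i\<in>R. (\<Sum>j\<in>I. f (i, j) * (w j - u j)) = 0" by blast
          then have "\<forall>i\<in>{..<k}. (\<Sum>j\<in>I. f (i, j) * (w j - u j)) = 0" by (rule R(3))
          then have eq: "(\<Sum>j\<in>I. f (i, j) * w j) = (\<Sum>j\<in>I. f (i, j) * u j)" if "i < k" for i
            using that by (simp add: right_diff_distrib sum_subtractf)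
          have "g' (i, k) = - (\<Sum>j\<in>I. f (i, j) * u j)" if "i < k" "i \<notin> R" for i
            using w eq that by fastforce
          then show "g' \<in> {g'. \<forall>x\<in>?B'. g' x = - (\<Sum>j\<in>I. f (fst x, j) * u j)}" by auto
        qed simp
        also have "\<dots> \<le> \<rho> ^ card ?B'" by (intro prob_iid_point_le \<rho>) auto
        finally show "measure_pmf.prob (iid \<xi> ?B') {g'. H I (merge_on ?A' g g')} \<le> \<rho> ^ card ?B'" .
      qed (use finR \<rho>0 in auto)
      also have "\<dots> \<le> 1 * \<rho> ^ card ?B'" using \<rho>0 by (intro mult_right_mono) auto
      also have "\<dots> \<le> \<rho> ^ (k - card I)"
        using R finR \<rho>0 \<rho>(2) by (simp add: card_cartesian_product card_Diff_subset power_decreasing)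
      finally show ?thesis by (simp only: split)
    qed
    have "measure_pmf.prob (iid \<xi> ?B) {g. E (merge_on ?A f g)} \<le> measure_pmf.prob (iid \<xi> ?B) (\<Union>I\<in>Ix. {g. H I g})"
    proof (intro measure_pmf.finite_measure_mono subsetI)
      fix g assume "g \<in> {g. E (merge_on ?A f g)}"
      then obtain v where v: "v k = 1" "card {j. j < k \<and> v j \<noteq> 0} \<le> s" "\<forall>i<k. (\<Sum>j<Suc k. merge_on ?A f g (i, j) * v j) = 0"
        unfolding E_def by blast
      define I where "I = {j. j < k \<and> v j \<noteq> 0}"
      have "(\<Sum>j\<in>I. f (i, j) * v j) + g (i, k) = 0" if "i < k" for i
      proof -
        have "(\<Sum>j<k. f (i, j) * v j) = (\<Sum>j\<in>I. f (i, j) * v j)"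
          by (rule sum.mono_neutral_right) (auto simp: I_def)
        then show ?thesis using v(1,3) that by auto
      qed
      then have "H I g" unfolding H_def by blast
      moreover have "I \<in> Ix" using v(2) by (auto simp: Ix_def I_def)
      ultimately show "g \<in> (\<Union>I\<in>Ix. {g. H I g})" by blast
    qed simp
    also have "\<dots> \<le> (\<Sum>I\<in>Ix. measure_pmf.prob (iid \<xi> ?B) {g. H I g})"
      by (intro measure_pmf.finite_measure_subadditive_finite finIx) auto
    also have "\<dots> \<le> (\<Sum>I\<in>Ix. \<rho> ^ (k - card I) * \<mu> ^ card I / \<mu> ^ s)"
    proof (rule sum_mono)
      fix I assume I: "I \<in> Ix"
      have "\<mu> ^ s \<le> \<mu> ^ card I" using I \<mu> by (intro power_decreasing) (auto simp: Ix_def)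
      then have "\<rho> ^ (k - card I) * 1 \<le> \<rho> ^ (k - card I) * (\<mu> ^ card I / \<mu> ^ s)"
        using \<rho>0 \<mu> by (intro mult_left_mono) auto
      then show "measure_pmf.prob (iid \<xi> ?B) {g. H I g} \<le> \<rho> ^ (k - card I) * \<mu> ^ card I / \<mu> ^ s"
        using HI[OF I] by simp
    qed
    also have "\<dots> \<le> (\<Sum>I\<in>Pow {..<k}. \<rho> ^ (k - card I) * \<mu> ^ card I / \<mu> ^ s)"
      using \<rho>0 \<mu> by (intro sum_mono2) (auto simp: Ix_def)
    also have "\<dots> = (\<Sum>I\<in>Pow {..<k}. (\<Prod>j\<in>I. \<mu>) * (\<Prod>j\<in>{..<k} - I. \<rho>)) / \<mu> ^ s"
      unfolding sum_divide_distrib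
      by (intro sum.cong refl) (auto simp: card_Diff_subset finite_subset[OF _ finite_lessThan])
    also have "\<dots> = (\<rho> + \<mu>) ^ k / \<mu> ^ s"
      using prod_add[of "{..<k}" "\<lambda>_. \<mu>" "\<lambda>_. \<rho>"] by (simp add: add.commute)
    finally show "measure_pmf.prob (iid \<xi> ?B) {g. E (merge_on ?A f g)} \<le> (\<rho> + \<mu>) ^ k / \<mu> ^ s" .
  qed (use \<rho>0 \<mu> in auto)
  moreover have "?A \<union> ?B = {..<k} \<times> {..<Suc k}" by (auto simp: less_Suc_eq)
  ultimately show ?thesis by (simp add: E_def)
qed

section \<open>Extending a nonsingular leading block\<close>

definition leading_nonzero :: "nat \<Rightarrow> (nat \<times> nat \<Rightarrow> real) \<Rightarrow> bool" where
  "leading_nonzero k f \<longleftrightarrow> (\<forall>j\<in>{1..k}. Determinant.det (mat j j f) \<noteq> 0)"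

definition prob_leading :: "real pmf \<Rightarrow> nat \<Rightarrow> real" where
  "prob_leading \<xi> k = measure_pmf.prob (iid \<xi> ({..<k} \<times> {..<k})) {f. leading_nonzero k f}"

text \<open>Values at indices above \<open>k\<close> are left free, so uniqueness can hold only up
  to \<open>k\<close>.\<close>

definition null_vector :: "nat \<Rightarrow> (nat \<times> nat \<Rightarrow> real) \<Rightarrow> (nat \<Rightarrow> real) \<Rightarrow> bool" where
  "null_vector k f v \<longleftrightarrow> v k = 1 \<and> (\<forall>i<k. (\<Sum>j<Suc k. f (i, j) * v j) = 0)"

lemma prob_random_matrix:
  "measure_pmf.prob (random_matrix n \<xi>) {A. strongly_nonsingular A} = prob_leading \<xi> n"
proof -
  have "strongly_nonsingular (mat n n f) \<longleftrightarrow> leading_nonzero n f" for f :: "nat \<times> nat \<Rightarrow> real"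
  proof -
    have "submatrix (mat n n f) {..<k} {..<k} = mat k k f" if "k \<in> {1..n}" for k
    proof -
      have "submatrix (mat n n f) {..<k} {..<k} = mat k k (\<lambda>ij. mat n n f $$ ij)"
        using that by (intro submatrix_leading) auto
      also have "\<dots> = mat k k f" using that by (intro eq_matI) auto
      finally show ?thesis .
    qed
    then show ?thesis by (simp add: strongly_nonsingular_def leading_nonzero_def)
  qed
  then show ?thesis by (simp add: random_matrix_def prob_leading_def vimage_def)
qed

lemma mat_cong_leading:
  assumes "\<And>i j. i < k \<Longrightarrow> j < k \<Longrightarrow> f (i, j) = g (i, j)" "m \<le> k"
  shows "mat m m f = mat m m g"
  using assms by (intro eq_matI) auto

lemma leading_nonzero_cong:
  assumes "\<And>i j. i < k \<Longrightarrow> j < k \<Longrightarrow> f (i, j) = g (i, j)"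
  shows "leading_nonzero k f \<longleftrightarrow> leading_nonzero k g"
proof -
  have "mat m m f = mat m m g" if "m \<in> {1..k}" for m
    using assms that by (intro mat_cong_leading[where k = k]) auto
  then show ?thesis by (simp add: leading_nonzero_def)
qed

lemma det_mat_eq_0_iff:
  fixes f :: "nat \<times> nat \<Rightarrow> real"
  shows "Determinant.det (mat n n f) = 0 \<longleftrightarrow>
    (\<exists>v. (\<exists>j<n. v j \<noteq> 0) \<and> (\<forall>i<n. (\<Sum>j<n. f (i, j) * v j) = 0))"
proof -
  have prod: "(mat n n f *\<^sub>v v) $ i = (\<Sum>j<n. f (i, j) * v $ j)" if "v \<in> carrier_vec n" "i < n" for v i
    using that by (auto simp: scalar_prod_def atLeast0LessThan intro!: sum.cong)
  have "Determinant.det (mat n n f) = 0 \<longleftrightarrow> (\<exists>v. v \<in> carrier_vec n \<and> v \<noteq> 0\<^sub>v n \<and> mat n n f *\<^sub>v v = 0\<^sub>v n)"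
    by (rule det_0_iff_vec_prod_zero) simp
  also have "\<dots> \<longleftrightarrow> (\<exists>v. (\<exists>j<n. v j \<noteq> 0) \<and> (\<forall>i<n. (\<Sum>j<n. f (i, j) * v j) = 0))"
  proof
    assume "\<exists>v. v \<in> carrier_vec n \<and> v \<noteq> 0\<^sub>v n \<and> mat n n f *\<^sub>v v = 0\<^sub>v n"
    then obtain v where v: "v \<in> carrier_vec n" "v \<noteq> 0\<^sub>v n" "mat n n f *\<^sub>v v = 0\<^sub>v n" by blast
    have "\<exists>j<n. v $ j \<noteq> 0" using v(1,2) by (metis carrier_vecD eq_vecI index_zero_vec)
    moreover have "\<forall>i<n. (\<Sum>j<n. f (i, j) * v $ j) = 0" using prod[OF v(1)] v(3) by (metis index_zero_vec(1))
    ultimately show "\<exists>v. (\<exists>j<n. v j \<noteq> 0) \<and> (\<forall>i<n. (\<Sum>j<n. f (i, j) * v j) = 0)"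
      by (intro exI[of _ "\<lambda>j. v $ j"]) blast
  next
    assume "\<exists>v. (\<exists>j<n. v j \<noteq> 0) \<and> (\<forall>i<n. (\<Sum>j<n. f (i, j) * v j) = 0)"
    then obtain v where v: "\<exists>j<n. v j \<noteq> 0" "\<forall>i<n. (\<Sum>j<n. f (i, j) * v j) = 0" by blast
    have "vec n v \<noteq> 0\<^sub>v n" using v(1) by (metis index_vec index_zero_vec(1))
    moreover have "mat n n f *\<^sub>v vec n v = 0\<^sub>v n"
      using prod[of "vec n v"] v(2) by (intro eq_vecI) (auto simp: prod)
    ultimately show "\<exists>v. v \<in> carrier_vec n \<and> v \<noteq> 0\<^sub>v n \<and> mat n n f *\<^sub>v v = 0\<^sub>v n"
      by (intro exI[of _ "vec n v"]) auto
  qed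
  finally show ?thesis .
qed

lemma leading_nonzero_kernel:
  fixes w :: "nat \<Rightarrow> real"
  assumes "leading_nonzero k f" "\<And>i. i < k \<Longrightarrow> (\<Sum>j<k. f (i, j) * w j) = 0" "j < k"
  shows "w j = 0"
proof (rule ccontr)
  assume "w j \<noteq> 0"
  then have "Determinant.det (mat k k f) = 0" unfolding det_mat_eq_0_iff using assms(2,3) by blast
  then show False using assms(1,3) by (auto simp: leading_nonzero_def)
qed

lemma null_vector_unique:
  assumes "leading_nonzero k f" "null_vector k f v" "null_vector k f w" "j < Suc k"
  shows "v j = w j"
proof (cases "j = k")
  case True
  then show ?thesis using assms(2,3) by (simp add: null_vector_def)
next
  case False
  have "v j - w j = 0"
  proof (rule leading_nonzero_kernel[OF assms(1), where w = "\<lambda>j. v j - w j"])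
    fix i assume "i < k"
    then have "(\<Sum>j<k. f (i, j) * v j) + f (i, k) = 0" "(\<Sum>j<k. f (i, j) * w j) + f (i, k) = 0"
      using assms(2,3) by (auto simp: null_vector_def)
    then show "(\<Sum>j<k. f (i, j) * (v j - w j)) = 0"
      by (simp add: right_diff_distrib sum_subtractf)
  qed (use False assms(4) in simp)
  then show ?thesis by simp
qed

lemma singular_extension:
  assumes "leading_nonzero k f" "Determinant.det (mat (Suc k) (Suc k) f) = 0"
  shows "\<exists>v. null_vector k f v \<and> (\<Sum>j<Suc k. f (k, j) * v j) = 0"
proof -
  obtain w where w: "\<exists>j<Suc k. w j \<noteq> 0" "\<forall>i<Suc k. (\<Sum>j<Suc k. f (i, j) * w j) = 0"
    using assms(2) unfolding det_mat_eq_0_iff by blast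
  have wk: "w k \<noteq> 0"
  proof
    assume "w k = 0"
    then have "(\<Sum>j<k. f (i, j) * w j) = 0" if "i < k" for i using w(2) that by auto
    then have "w j = 0" if "j < k" for j using leading_nonzero_kernel[OF assms(1)] that by blast
    then show False using w(1) \<open>w k = 0\<close> by (auto simp: less_Suc_eq)
  qed
  have "(\<Sum>j<Suc k. f (i, j) * (w j / w k)) = 0" if "i < Suc k" for i
  proof -
    have "(\<Sum>j<Suc k. f (i, j) * (w j / w k)) = (\<Sum>j<Suc k. f (i, j) * w j) / w k"
      unfolding sum_divide_distrib by simp
    then show ?thesis using w(2) that by simp
  qed
  then show ?thesis using wk by (intro exI[of _ "\<lambda>j. w j / w k"]) (auto simp: null_vector_def)
qed

text \<open>The two exceptional classes enter differently: the bound for \<open>sparse\<close> is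
  conditional on the block and carries the factor \<open>prob_leading \<xi> k\<close>, the bound
  \<open>t\<close> for \<open>structured\<close> is not and is subtracted as it stands. For all
  other vectors the last row is independent of the first \<open>k\<close> rows, which determine the
  null vector.\<close>

lemma prob_leading_Suc_ge:
  fixes sparse structured :: "(nat \<Rightarrow> real) \<Rightarrow> bool"
  assumes q: "q \<ge> 0"
    and sp: "measure_pmf.prob (iid \<xi> ({..<k} \<times> {..<Suc k})) {f. leading_nonzero k f \<and> (\<exists>v. null_vector k f v \<and> sparse v)}
      \<le> prob_leading \<xi> k * e"
    and st: "measure_pmf.prob (iid \<xi> ({..<k} \<times> {..<Suc k})) {f. \<exists>v. null_vector k f v \<and> structured v} \<le> t"
    and row: "\<And>v. v k = 1 \<Longrightarrow> \<not> sparse v \<Longrightarrow> \<not> structured v \<Longrightarrow>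
      measure_pmf.prob (iid \<xi> ({k} \<times> {..<Suc k})) {f. (\<Sum>j<Suc k. f (k, j) * v j) = 0} \<le> q"
  shows "prob_leading \<xi> (Suc k) \<ge> prob_leading \<xi> k * (1 - e - q) - t"
proof -
  let ?A = "{..<k} \<times> {..<Suc k}" and ?B = "{k} \<times> {..<Suc k}"
  let ?M = "iid \<xi> ({..<Suc k} \<times> {..<Suc k})"
  define good where "good = (\<lambda>v. \<not> sparse v \<and> \<not> structured v)"
  \<comment> \<open>Any choice will do: on a nonsingular block it agrees up to index
    \<open>k\<close> with the vector from \<open>singular_extension\<close>.\<close>
  define V where "V = (\<lambda>f. SOME v. null_vector k f v \<and> good v)"
  have AB: "{..<Suc k} \<times> {..<Suc k} = ?A \<union> ?B" by auto
  have null_cong: "null_vector k f = null_vector k g" if "\<And>x. x \<in> ?A \<Longrightarrow> f x = g x" for f g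
    using that by (simp add: null_vector_def fun_eq_iff)
  have lead_cong: "leading_nonzero k f = leading_nonzero k g" if "\<And>x. x \<in> ?A \<Longrightarrow> f x = g x" for f g
    using that by (intro leading_nonzero_cong) auto
  define E1 where "E1 = (\<lambda>f. leading_nonzero k f \<and> (\<exists>v. null_vector k f v \<and> sparse v))"
  define E2 where "E2 = (\<lambda>f. \<exists>v. null_vector k f v \<and> structured v)"
  define E3 where "E3 = (\<lambda>f. leading_nonzero k f \<and> (\<exists>v. null_vector k f v \<and> good v) \<and> (\<Sum>j<Suc k. f (k, j) * V f j) = 0)"
  have E1: "measure_pmf.prob ?M {f. E1 f} \<le> prob_leading \<xi> k * e"
  proof -
    have "measure_pmf.prob ?M {f. E1 f} = measure_pmf.prob (iid \<xi> ?A) {f. E1 f}"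
    proof (rule prob_iid_subset)
      fix f g :: "nat \<times> nat \<Rightarrow> real" assume "\<And>x. x \<in> ?A \<Longrightarrow> f x = g x"
      then show "E1 f = E1 g" unfolding E1_def using null_cong[of f g] lead_cong[of f g] by simp
    qed auto
    then show ?thesis using sp by (simp add: E1_def)
  qed
  have E2: "measure_pmf.prob ?M {f. E2 f} \<le> t"
  proof -
    have "measure_pmf.prob ?M {f. E2 f} = measure_pmf.prob (iid \<xi> ?A) {f. E2 f}"
    proof (rule prob_iid_subset)
      fix f g :: "nat \<times> nat \<Rightarrow> real" assume "\<And>x. x \<in> ?A \<Longrightarrow> f x = g x"
      then show "E2 f = E2 g" unfolding E2_def using null_cong[of f g] by simp
    qed auto
    then show ?thesis using st by (simp add: E2_def)
  qed
  have lead_M: "measure_pmf.prob (iid \<xi> S) {f. leading_nonzero k f} = prob_leading \<xi> k"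
    if "{..<k} \<times> {..<k} \<subseteq> S" "finite S" for S
    unfolding prob_leading_def
    by (rule prob_iid_subset[OF that(2,1)]) (auto intro!: leading_nonzero_cong)
  have E3: "measure_pmf.prob ?M {f. E3 f} \<le> prob_leading \<xi> k * q"
  proof -
    let ?Q = "\<lambda>f. leading_nonzero k f \<and> (\<exists>v. null_vector k f v \<and> good v)"
    have mnull: "null_vector k (merge_on ?A f g) = null_vector k f" for f g by (rule null_cong) simp
    have mlead: "leading_nonzero k (merge_on ?A f g) = leading_nonzero k f" for f g by (rule lead_cong) simp
    have mV: "V (merge_on ?A f g) = V f" for f g by (simp add: V_def mnull)
    have "measure_pmf.prob (iid \<xi> (?A \<union> ?B)) {f. E3 f} \<le> measure_pmf.prob (iid \<xi> ?A) {f. ?Q f} * q"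
    proof (rule prob_iid_Un_le)
      fix f g assume "E3 (merge_on ?A f g)"
      then show "?Q f" by (simp add: E3_def mnull mlead)
    next
      fix f assume "?Q f"
      then have "null_vector k f (V f) \<and> good (V f)"
        unfolding V_def by (intro someI_ex[of "\<lambda>v. null_vector k f v \<and> good v"]) blast
      then have V: "V f k = 1" "good (V f)" by (auto simp: null_vector_def)
      have "measure_pmf.prob (iid \<xi> ?B) {g. E3 (merge_on ?A f g)}
          \<le> measure_pmf.prob (iid \<xi> ?B) {g. (\<Sum>j<Suc k. g (k, j) * V f j) = 0}"
        by (intro measure_pmf.finite_measure_mono) (auto simp: E3_def mV)
      also have "\<dots> \<le> q" using V by (intro row) (auto simp: good_def)
      finally show "measure_pmf.prob (iid \<xi> ?B) {g. E3 (merge_on ?A f g)} \<le> q" .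
    qed (use q in auto)
    also have "measure_pmf.prob (iid \<xi> ?A) {f. ?Q f} \<le> measure_pmf.prob (iid \<xi> ?A) {f. leading_nonzero k f}"
      by (intro measure_pmf.finite_measure_mono) auto
    also have "\<dots> = prob_leading \<xi> k" by (rule lead_M) auto
    finally show ?thesis using q by (simp add: AB mult_right_mono)
  qed
  have lead_Suc: "leading_nonzero (Suc k) f \<longleftrightarrow> leading_nonzero k f \<and> Determinant.det (mat (Suc k) (Suc k) f) \<noteq> 0" for f
    by (simp add: leading_nonzero_def atLeastAtMostSuc_conv conj_commute)
  have cover: "{f. leading_nonzero k f} \<subseteq> {f. leading_nonzero (Suc k) f} \<union> ({f. E1 f} \<union> ({f. E2 f} \<union> {f. E3 f}))"
  proof
    fix f assume "f \<in> {f. leading_nonzero k f}"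
    then have lead: "leading_nonzero k f" by simp
    show "f \<in> {f. leading_nonzero (Suc k) f} \<union> ({f. E1 f} \<union> ({f. E2 f} \<union> {f. E3 f}))"
    proof (cases "Determinant.det (mat (Suc k) (Suc k) f) = 0")
      case True
      obtain v where v: "null_vector k f v" "(\<Sum>j<Suc k. f (k, j) * v j) = 0"
        using singular_extension[OF lead True] by blast
      show ?thesis
      proof (cases "good v")
        case True
        then have "null_vector k f (V f) \<and> good (V f)"
          unfolding V_def using v(1) by (intro someI_ex[of "\<lambda>v. null_vector k f v \<and> good v"]) blast
        then have eq: "V f j = v j" if "j < Suc k" for j
          using null_vector_unique[OF lead _ v(1) that] by blast
        have "(\<Sum>j<Suc k. f (k, j) * V f j) = (\<Sum>j<Suc k. f (k, j) * v j)"
          using eq by (intro sum.cong) auto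
        then have "E3 f" using lead v True by (auto simp: E3_def)
        then show ?thesis by blast
      qed (use lead v in \<open>auto simp: good_def E1_def E2_def\<close>)
    qed (use lead in \<open>simp add: lead_Suc\<close>)
  qed
  have "prob_leading \<xi> k = measure_pmf.prob ?M {f. leading_nonzero k f}"
    by (rule lead_M [symmetric]) auto
  also have "\<dots> \<le> measure_pmf.prob ?M ({f. leading_nonzero (Suc k) f} \<union> ({f. E1 f} \<union> ({f. E2 f} \<union> {f. E3 f})))"
    using cover by (intro measure_pmf.finite_measure_mono) auto
  also have "\<dots> \<le> measure_pmf.prob ?M {f. leading_nonzero (Suc k) f} + (measure_pmf.prob ?M {f. E1 f}
      + (measure_pmf.prob ?M {f. E2 f} + measure_pmf.prob ?M {f. E3 f}))"
    by (intro order_trans[OF measure_Un_le] add_mono order_refl) auto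
  also have "\<dots> \<le> prob_leading \<xi> (Suc k) + (prob_leading \<xi> k * e + (t + prob_leading \<xi> k * q))"
    using E1 E2 E3 by (simp add: prob_leading_def)
  finally show ?thesis by (simp add: algebra_simps)
qed

section \<open>The crude exponential lower bound\<close>

lemma max_atom_ge: "pmf \<xi> x \<le> max_atom \<xi>"
  using max_atom_attained[of \<xi>] by metis

text \<open>The entry in the last column has coefficient 1, so the rest of the row leaves it a
  single value.\<close>

lemma prob_row_le_max_atom:
  assumes "v k = (1::real)"
  shows "measure_pmf.prob (iid \<xi> ({k} \<times> {..<Suc k})) {f. (\<Sum>j<Suc k. f (k, j) * v j) = 0} \<le> max_atom \<xi>"
proof -
  let ?A = "{k} \<times> {..<k}" and ?B = "{(k, k)}"
  have \<rho>0: "0 \<le> max_atom \<xi>" using max_atom_ge[of \<xi> 0] pmf_nonneg[of \<xi> 0] by linarith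
  have "measure_pmf.prob (iid \<xi> (?A \<union> ?B)) {f. (\<Sum>j<Suc k. f (k, j) * v j) = 0}
      \<le> measure_pmf.prob (iid \<xi> ?A) {f. True} * max_atom \<xi>"
  proof (rule prob_iid_Un_le)
    fix f :: "nat \<times> nat \<Rightarrow> real"
    have "measure_pmf.prob (iid \<xi> ?B) {g. (\<Sum>j<Suc k. merge_on ?A f g (k, j) * v j) = 0}
        \<le> measure_pmf.prob (iid \<xi> ?B) {g. \<forall>x\<in>?B. g x = - (\<Sum>j<k. f (k, j) * v j)}"
      using assms by (intro measure_pmf.finite_measure_mono) (auto simp: add_eq_0_iff)
    also have "\<dots> \<le> max_atom \<xi> ^ card ?B"
      by (rule prob_iid_point_le) (auto simp: max_atom_ge)
    finally show "measure_pmf.prob (iid \<xi> ?B) {g. (\<Sum>j<Suc k. merge_on ?A f g (k, j) * v j) = 0} \<le> max_atom \<xi>" by simp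
  qed (use \<rho>0 in auto)
  moreover have "?A \<union> ?B = {k} \<times> {..<Suc k}" by auto
  ultimately show ?thesis by simp
qed

lemma prob_leading_Suc_ge_atom: "prob_leading \<xi> (Suc k) \<ge> prob_leading \<xi> k * (1 - max_atom \<xi>)"
proof -
  have "0 \<le> max_atom \<xi>" using max_atom_ge[of \<xi> 0] pmf_nonneg[of \<xi> 0] by linarith
  then show ?thesis
    using prob_leading_Suc_ge[where \<xi> = \<xi> and k = k and q = "max_atom \<xi>" and e = 0 and t = 0
      and sparse = "\<lambda>_. False" and structured = "\<lambda>_. False"] prob_row_le_max_atom
    by simp
qed

text \<open>Too weak by itself, but it turns an unconditional exponentially small probability into a
  multiple of \<open>prob_leading \<xi> k\<close>, and it gives the recursion a positive
  start.\<close>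

lemma prob_leading_ge_power:
  assumes "max_atom \<xi> \<le> 1"
  shows "prob_leading \<xi> k \<ge> (1 - max_atom \<xi>) ^ k"
proof (induction k)
  case 0
  show ?case by (simp add: prob_leading_def leading_nonzero_def)
next
  case (Suc k)
  have "(1 - max_atom \<xi>) ^ Suc k \<le> prob_leading \<xi> k * (1 - max_atom \<xi>)"
    using mult_right_mono[OF Suc, of "1 - max_atom \<xi>"] assms by (simp add: mult.commute)
  then show ?case using prob_leading_Suc_ge_atom[of \<xi> k] by linarith
qed

text \<open>From an index \<open>K\<close> with tail sums at most 1/2 on, the product of the factors
  \<open>1 - r n\<close> is at least 1 minus the sum of the \<open>r n\<close>, hence at least 1/2.
  Below \<open>K\<close>, where the recursion may fail, \<open>pos\<close> provides the
  bound.\<close>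

lemma bounded_below_of_summable_loss:
  fixes g r :: "nat \<Rightarrow> real"
  assumes pos: "\<And>n. g n \<ge> \<kappa> ^ n" and \<kappa>: "0 < \<kappa>" "\<kappa> \<le> 1"
    and rec: "eventually (\<lambda>n. g (Suc n) \<ge> g n * (1 - r n)) sequentially"
    and r: "\<And>n. r n \<ge> 0" "summable r"
  shows "\<exists>C>0. \<forall>n. g n \<ge> C"
proof -
  obtain K1 where K1: "\<And>n. n \<ge> K1 \<Longrightarrow> g (Suc n) \<ge> g n * (1 - r n)"
    using rec by (auto simp: eventually_sequentially)
  obtain K2 where K2: "\<And>m n. m \<ge> K2 \<Longrightarrow> norm (sum r {m..<n}) < 1 / 2"
    using r(2)[unfolded summable_Cauchy, rule_format, of "1 / 2"] by auto
  define K where "K = max K1 K2"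
  have small: "sum r {K..<n} \<le> 1 / 2" for n using K2[of K n] by (simp add: K_def)
  have gK: "g K > 0" using pos[of K] \<kappa> by (smt (verit) zero_less_power)
  have ge: "g n \<ge> g K * (1 - sum r {K..<n})" if "n \<ge> K" for n
    using that
  proof (induction n rule: dec_induct)
    case (step n)
    have rn: "r n \<le> 1 / 2" using small[of "Suc n"] step.hyps sum_nonneg[of "{K..<n}" r] r(1) by (simp add: atLeastLessThanSuc)
    have "g K * (1 - sum r {K..<Suc n}) \<le> g K * ((1 - sum r {K..<n}) * (1 - r n))"
    proof (rule mult_left_mono)
      have "0 \<le> sum r {K..<n} * r n" using r(1) by (intro mult_nonneg_nonneg sum_nonneg) auto
      then show "1 - sum r {K..<Suc n} \<le> (1 - sum r {K..<n}) * (1 - r n)"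
        using step.hyps by (simp add: algebra_simps)
    qed (use gK in simp)
    also have "\<dots> \<le> g n * (1 - r n)"
      using step.IH rn by (simp add: mult.assoc [symmetric] mult_right_mono)
    also have "\<dots> \<le> g (Suc n)" using K1[of n] step.hyps by (simp add: K_def)
    finally show ?case .
  qed simp
  have "g n \<ge> \<kappa> ^ K / 2" for n
  proof (cases "n \<ge> K")
    case True
    have "\<kappa> ^ K / 2 \<le> g K * (1 / 2)" using pos[of K] by simp
    also have "\<dots> \<le> g K * (1 - sum r {K..<n})" using gK small[of n] by (intro mult_left_mono) auto
    finally show ?thesis using ge[OF True] by linarith
  next
    case False
    have "\<kappa> ^ K / 2 \<le> \<kappa> ^ K" using \<kappa> by simp
    also have "\<dots> \<le> \<kappa> ^ n" using False \<kappa> by (intro power_decreasing) auto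
    finally show ?thesis using pos[of n] by linarith
  qed
  then show ?thesis using \<kappa> by (intro exI[of _ "\<kappa> ^ K / 2"]) auto
qed

text \<open>To leading order the labellings contribute \<open>k powr (a * k)\<close> and the rows
  \<open>k powr (- 9 / 10 * b * k)\<close>, so the product beats every exponential if
  \<open>a < 9 / 10 * b\<close>. The logarithm of the claim is kept as the hypothesis
  \<open>lim\<close>, to be checked for numerical exponents.\<close>

lemma eventually_superexponential:
  fixes a b c M :: real
  assumes c: "c > 0" and b: "b > 0"
    and lim: "filterlim (\<lambda>k. (real k + 1) * ln (2 * real k powr a + 1) + real k * ln 2
      + (9 / 10 * real k - 2 * real k powr a) * (ln c - b * ln (real k)) - real k * M) at_bot sequentially"
    and small: "filterlim (\<lambda>k. ln c - b * ln (real k)) at_bot sequentially"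
  shows "eventually (\<lambda>k. \<forall>D \<rho>. real D \<le> 2 * real k powr a \<longrightarrow> 0 \<le> \<rho> \<longrightarrow> \<rho> \<le> c * real k powr (- b) \<longrightarrow>
    (real D + 1) ^ Suc k * 2 ^ k * \<rho> ^ (k - (D + k div 10)) \<le> exp M ^ k) sequentially"
proof -
  have "eventually (\<lambda>k. (real k + 1) * ln (2 * real k powr a + 1) + real k * ln 2
      + (9 / 10 * real k - 2 * real k powr a) * (ln c - b * ln (real k)) - real k * M \<le> 0) sequentially"
    using lim unfolding filterlim_at_bot by blast
  moreover have "eventually (\<lambda>k. ln c - b * ln (real k) \<le> 0) sequentially"
    using small unfolding filterlim_at_bot by blast
  ultimately show ?thesis
    using eventually_gt_at_top[of 0]
  proof eventually_elim
    case (elim k)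
    show ?case
    proof (intro allI impI)
      fix D \<rho> assume D: "real D \<le> 2 * real k powr a" and \<rho>: "0 \<le> \<rho>" "\<rho> \<le> c * real k powr (- b)"
      define l where "l = ln c - b * ln (real k)"
      define e where "e = k - (D + k div 10)"
      have cl: "c * real k powr (- b) = exp l"
        using c elim(3) by (simp add: l_def exp_diff powr_def exp_minus divide_inverse)
      have e: "9 / 10 * real k - 2 * real k powr a \<le> real e"
      proof -
        have "real (k div 10) \<le> real k / 10" using times_div_less_eq_dividend[of 10 k] by linarith
        moreover have "real k - (real D + real (k div 10)) \<le> real e" unfolding e_def by linarith
        ultimately show ?thesis using D by linarith
      qed
      have "(real D + 1) ^ Suc k * 2 ^ k * \<rho> ^ e \<le> (2 * real k powr a + 1) ^ Suc k * 2 ^ k * exp l ^ e"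
        using D \<rho> by (intro mult_mono power_mono) (auto simp: cl)
      also have "\<dots> = exp ((real k + 1) * ln (2 * real k powr a + 1) + real k * ln 2 + real e * l)"
      proof -
        have "0 < 2 * real k powr a + 1" by (simp add: add_nonneg_pos)
        then have "(2 * real k powr a + 1) ^ Suc k = exp (real (Suc k) * ln (2 * real k powr a + 1))"
          by (simp add: exp_of_nat_mult del: of_nat_Suc)
        moreover have "(2::real) ^ k = exp (real k * ln 2)" by (simp add: exp_of_nat_mult)
        moreover have "exp l ^ e = exp (real e * l)" by (simp add: exp_of_nat_mult)
        ultimately show ?thesis by (simp add: exp_add add.commute)
      qed
      also have "\<dots> \<le> exp (real k * M)"
      proof -
        \<comment> \<open>\<open>e\<close> is bounded only from below, hence the need for
          \<open>l\<close> to be nonpositive.\<close>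
        have "real e * l \<le> (9 / 10 * real k - 2 * real k powr a) * l"
          using e elim(2) by (intro mult_right_mono_neg) (auto simp: l_def)
        then show ?thesis using elim(1) by (simp add: l_def)
      qed
      finally show "(real D + 1) ^ Suc k * 2 ^ k * \<rho> ^ (k - (D + k div 10)) \<le> exp M ^ k"
        by (simp add: e_def exp_of_nat_mult)
    qed
  qed
qed

text \<open>Here \<open>7 / 20 < 9 / 10 * (1 / 2)\<close>; \<open>c\<close> stands for the logarithm
  of the constant in the row bound.\<close>

lemma filterlim_stage1:
  "filterlim (\<lambda>k. (real k + 1) * ln (2 * real k powr (7 / 20) + 1) + real k * ln 2
      + (9 / 10 * real k - 2 * real k powr (7 / 20)) * (c - 1 / 2 * ln (real k)) - real k * M) at_bot sequentially"
  by real_asymp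

text \<open>Here \<open>3 / 5 < 9 / 10 * (17 / 20)\<close>, with the row bound won in the first
  round.\<close>

lemma filterlim_stage2:
  "filterlim (\<lambda>k. (real k + 1) * ln (2 * real k powr (3 / 5) + 1) + real k * ln 2
      + (9 / 10 * real k - 2 * real k powr (3 / 5)) * (c - 17 / 20 * ln (real k)) - real k * M) at_bot sequentially"
  by real_asymp

section \<open>Row bounds and the choice of parameters\<close>

lemma max_atom_nonneg: "0 \<le> max_atom \<xi>"
  using max_atom_ge[of \<xi> 0] pmf_nonneg[of \<xi> 0] by (rule order_trans[rotated])

definition concentration_const :: "real pmf \<Rightarrow> real \<Rightarrow> bool" where
  "concentration_const \<xi> C \<longleftrightarrow> C > 0 \<and> (\<forall>(J :: (nat \<times> nat) set) v m s. finite J \<longrightarrow> 0 < m \<longrightarrow> m \<le> card J \<longrightarrow>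
    (\<forall>x. card {j \<in> J. v j = x} + card {j \<in> J. v j = - x} \<le> m) \<longrightarrow>
    measure_pmf.prob (iid \<xi> J) {f. (\<Sum>j\<in>J. v j * f j) = s} \<le> C * m / (card J * sqrt (card J)))"

lemma concentration_const_exists:
  assumes "finite (set_pmf \<xi>)" "max_atom \<xi> < 1"
  shows "\<exists>C. concentration_const \<xi> C"
proof -
  obtain a where a: "a \<in> set_pmf \<xi>" using set_pmf_not_empty[of \<xi>] by blast
  have "\<exists>b\<in>set_pmf \<xi>. b \<noteq> a"
  proof (rule ccontr)
    assume "\<not> ?thesis"
    then have "set_pmf \<xi> \<subseteq> {a}" by auto
    then have "\<xi> = return_pmf a" by (simp add: set_pmf_subset_singleton)
    then have "pmf \<xi> a = 1" by simp
    then show False using assms(2) max_atom_ge[of \<xi> a] by simp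
  qed
  then obtain b where "b \<in> set_pmf \<xi>" "a \<noteq> b" by blast
  then show ?thesis
    using prob_sum_eq_le_multiplicity[OF assms(1) a, of b, where ?'i = "nat \<times> nat"]
    unfolding concentration_const_def by blast
qed

text \<open>The entries outside \<open>J\<close> only shift the target value, in which the
  concentration bound is uniform.\<close>

lemma prob_row_le_concentration:
  fixes v :: "nat \<Rightarrow> real" and i :: nat
  assumes C: "concentration_const \<xi> C" and J: "J \<subseteq> {..<n}" and m: "0 < m" "m \<le> card J"
    and mult: "\<And>x. card {j \<in> J. v j = x} + card {j \<in> J. v j = - x} \<le> m"
  shows "measure_pmf.prob (iid \<xi> ({i} \<times> {..<n})) {f. (\<Sum>j<n. f (i, j) * v j) = 0} \<le> C * m / (card J * sqrt (card J))"
proof -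
  let ?A = "{i} \<times> ({..<n} - J)" and ?B = "{i} \<times> J"
  define r where "r = C * m / (card J * sqrt (card J))"
  have r: "r \<ge> 0" using C by (simp add: r_def concentration_const_def)
  have finJ: "finite J" using J finite_subset by blast
  have level: "card {p \<in> ?B. v (snd p) = x} = card {j \<in> J. v j = x}" for x
  proof -
    have "{p \<in> ?B. v (snd p) = x} = Pair i ` {j \<in> J. v j = x}" by auto
    then show ?thesis by (simp add: card_image inj_on_def)
  qed
  have cardB: "card ?B = card J" by (simp add: card_cartesian_product)
  have "measure_pmf.prob (iid \<xi> (?A \<union> ?B)) {f. (\<Sum>j<n. f (i, j) * v j) = 0}
      \<le> measure_pmf.prob (iid \<xi> ?A) {f. True} * r"
  proof (rule prob_iid_Un_le)
    fix f :: "nat \<times> nat \<Rightarrow> real"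
    have "(\<Sum>j<n. merge_on ?A f g (i, j) * v j) = (\<Sum>j\<in>{..<n} - J. f (i, j) * v j) + (\<Sum>p\<in>?B. v (snd p) * g p)" for g
    proof -
      have "(\<Sum>p\<in>?B. v (snd p) * g p) = (\<Sum>j\<in>J. v j * g (i, j))"
      proof -
        have "?B = Pair i ` J" by auto
        then show ?thesis by (simp add: sum.reindex inj_on_def)
      qed
      moreover have "(\<Sum>j<n. merge_on ?A f g (i, j) * v j)
          = (\<Sum>j\<in>{..<n} - J. merge_on ?A f g (i, j) * v j) + (\<Sum>j\<in>J. merge_on ?A f g (i, j) * v j)"
        using J by (intro sum.subset_diff) auto
      ultimately show ?thesis by (simp add: mult.commute)
    qed
    then have "{g. (\<Sum>j<n. merge_on ?A f g (i, j) * v j) = 0}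
        = {g. (\<Sum>p\<in>?B. v (snd p) * g p) = - (\<Sum>j\<in>{..<n} - J. f (i, j) * v j)}"
      by (auto simp: add_eq_0_iff)
    then show "measure_pmf.prob (iid \<xi> ?B) {g. (\<Sum>j<n. merge_on ?A f g (i, j) * v j) = 0} \<le> r"
      using C[unfolded concentration_const_def, THEN conjunct2, rule_format, of ?B m "\<lambda>p. v (snd p)"] finJ m mult
      by (simp add: level cardB r_def)
  qed (use finJ r in auto)
  moreover have "?A \<union> ?B = {i} \<times> {..<n}" using J by auto
  ultimately show ?thesis by (simp add: r_def)
qed

text \<open>The Littlewood-Offord case \<open>m = card J\<close>, with \<open>J\<close> the support:
  0 does not occur as a value, and for \<open>x\<close> nonzero the levels of \<open>x\<close> and
  \<open>- x\<close> are disjoint subsets of \<open>J\<close>.\<close>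

lemma prob_row_le_support:
  fixes v :: "nat \<Rightarrow> real" and i :: nat
  assumes C: "concentration_const \<xi> C" and s: "0 < s" "s \<le> real (card {j. j < k \<and> v j \<noteq> 0})"
  shows "measure_pmf.prob (iid \<xi> ({i} \<times> {..<Suc k})) {f. (\<Sum>j<Suc k. f (i, j) * v j) = 0} \<le> C / sqrt s"
proof -
  define J where "J = {j. j < k \<and> v j \<noteq> 0}"
  have cJ: "0 < card J" using s by (cases "card J") (auto simp: J_def)
  have "card {j \<in> J. v j = x} + card {j \<in> J. v j = - x} \<le> card J" for x
  proof (cases "x = 0")
    case False
    have "card {j \<in> J. v j = x} + card {j \<in> J. v j = - x} = card ({j \<in> J. v j = x} \<union> {j \<in> J. v j = - x})"
      using False by (intro card_Un_disjoint [symmetric]) (auto simp: J_def)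
    also have "\<dots> \<le> card J" by (intro card_mono) (auto simp: J_def)
    finally show ?thesis .
  qed (simp add: J_def)
  then have "measure_pmf.prob (iid \<xi> ({i} \<times> {..<Suc k})) {f. (\<Sum>j<Suc k. f (i, j) * v j) = 0}
      \<le> C * card J / (card J * sqrt (card J))"
    by (intro prob_row_le_concentration[OF C]) (use cJ in \<open>auto simp: J_def\<close>)
  also have "\<dots> = C / sqrt (card J)" using cJ by simp
  also have "\<dots> \<le> C / sqrt s"
    using s C by (intro divide_left_mono) (auto simp: J_def concentration_const_def)
  finally show ?thesis .
qed

definition rare_coords :: "nat \<Rightarrow> nat \<Rightarrow> (nat \<Rightarrow> real) \<Rightarrow> nat set" where
  "rare_coords n m v = {j. j < n \<and> card {i. i < n \<and> v i = v j} \<le> m}"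

text \<open>On the rare coordinates each value has multiplicity at most \<open>m\<close>, so
  \<open>x\<close> and \<open>- x\<close> together have at most \<open>2 * m\<close>.\<close>

lemma prob_row_le_rare:
  fixes i :: nat
  assumes C: "concentration_const \<xi> C" and m: "0 < m" "2 * m \<le> F" and F: "F < card (rare_coords n m v)"
  shows "measure_pmf.prob (iid \<xi> ({i} \<times> {..<n})) {f. (\<Sum>j<n. f (i, j) * v j) = 0}
    \<le> C * (2 * real m) / (F * sqrt F)"
proof -
  define J where "J = rare_coords n m v"
  have level: "card {j \<in> J. v j = x} \<le> m" for x
  proof (cases "{j \<in> J. v j = x} = {}")
    case False
    then obtain j where j: "j \<in> J" "v j = x" by blast
    have "card {j \<in> J. v j = x} \<le> card {i. i < n \<and> v i = v j}"
      using j by (intro card_mono) (auto simp: J_def rare_coords_def)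
    also have "\<dots> \<le> m" using j by (simp add: J_def rare_coords_def)
    finally show ?thesis .
  next
    case True
    then show ?thesis by (simp only: card.empty le0)
  qed
  have "measure_pmf.prob (iid \<xi> ({i} \<times> {..<n})) {f. (\<Sum>j<n. f (i, j) * v j) = 0}
      \<le> C * real (2 * m) / (card J * sqrt (card J))"
  proof (rule prob_row_le_concentration[OF C])
    show "card {j \<in> J. v j = x} + card {j \<in> J. v j = - x} \<le> 2 * m" for x
      using level[of x] level[of "- x"] by linarith
  qed (use m F in \<open>auto simp: J_def rare_coords_def\<close>)
  also have "\<dots> \<le> C * real (2 * m) / (F * sqrt F)"
  proof (rule divide_left_mono)
    show "F * sqrt F \<le> card J * sqrt (card J)"
      using F by (intro mult_mono) (auto simp: J_def)
  qed (use C m F in \<open>auto simp: J_def concentration_const_def\<close>)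
  finally show ?thesis by simp
qed

text \<open>The two rounds of the union bound. In the first, large support gives the row bound; in
  the second, more than \<open>F\<close> rare coordinates at level \<open>m1\<close> give a better
  one. A vector of support above \<open>S\<close> that escapes both alternatives has more than
  \<open>F\<close> rare coordinates at level \<open>m2\<close>.\<close>

lemma prob_structured_le:
  assumes C: "concentration_const \<xi> C" and s: "0 < s"
    and sS: "\<And>c :: nat. S < c \<Longrightarrow> s \<le> real c"
    and m: "0 < m1" "2 * m1 \<le> F"
    and \<rho>0: "C / sqrt s \<le> 1" and \<rho>1: "C * (2 * real m1) / (F * sqrt F) \<le> 1"
  shows "measure_pmf.prob (iid \<xi> ({..<k} \<times> {..<Suc k})) {f. \<exists>v. null_vector k f v \<and>
      (S < card {j. j < k \<and> v j \<noteq> 0} \<and> card (rare_coords (Suc k) m1 v) \<le> F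
      \<or> F < card (rare_coords (Suc k) m1 v) \<and> card (rare_coords (Suc k) m2 v) \<le> F)}
    \<le> (real (Suc k div Suc m1) + 1) ^ Suc k * 2 ^ k * (C / sqrt s) ^ (k - (Suc k div Suc m1 + F))
      + (real (Suc k div Suc m2) + 1) ^ Suc k * 2 ^ k * (C * (2 * real m1) / (F * sqrt F)) ^ (k - (Suc k div Suc m2 + F))"
    (is "measure_pmf.prob ?M ?E \<le> ?b1 + ?b2")
proof -
  have C0: "C > 0" using C by (simp add: concentration_const_def)
  let ?E1 = "{f. \<exists>v. S < card {j. j < k \<and> v j \<noteq> 0} \<and> card {j. j < Suc k \<and> card {i. i < Suc k \<and> v i = v j} \<le> m1} \<le> F
      \<and> (\<forall>i<k. (\<Sum>j<Suc k. f (i, j) * v j) = 0)}"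
  let ?E2 = "{f. \<exists>v. F < card (rare_coords (Suc k) m1 v) \<and> card {j. j < Suc k \<and> card {i. i < Suc k \<and> v i = v j} \<le> m2} \<le> F
      \<and> (\<forall>i<k. (\<Sum>j<Suc k. f (i, j) * v j) = 0)}"
  have "measure_pmf.prob ?M ?E \<le> measure_pmf.prob ?M (?E1 \<union> ?E2)"
    by (intro measure_pmf.finite_measure_mono) (unfold null_vector_def rare_coords_def, blast, simp)
  also have "\<dots> \<le> measure_pmf.prob ?M ?E1 + measure_pmf.prob ?M ?E2" by (rule measure_Un_le) auto
  also have "measure_pmf.prob ?M ?E1 \<le> ?b1"
    using C0 s \<rho>0 by (intro prob_structured_null_vector_le prob_row_le_support[OF C s] sS) auto
  also have "measure_pmf.prob ?M ?E2 \<le> ?b2"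
    using C0 \<rho>1 by (intro prob_structured_null_vector_le prob_row_le_rare[OF C m]) auto
  finally show ?thesis by simp
qed

lemma prob_leading_step:
  assumes C: "concentration_const \<xi> C" and \<xi>: "max_atom \<xi> < 1"
  shows "\<exists>r. (\<forall>k. 0 \<le> r k) \<and> summable r \<and>
    eventually (\<lambda>k. prob_leading \<xi> (Suc k) \<ge> prob_leading \<xi> k * (1 - r k)) sequentially"
proof -
  define \<rho> where "\<rho> = max_atom \<xi>"
  have C0: "C > 0" using C by (simp add: concentration_const_def)
  have \<rho>: "0 \<le> \<rho>" "\<rho> < 1" using max_atom_nonneg[of \<xi>] \<xi> by (simp_all add: \<rho>_def)
  \<comment> \<open>The halving serves twice: \<open>\<theta> = (1 + \<rho>) / 2\<close> stays below
    1, and \<open>\<mu> ^ k\<close> is \<open>(1 / 2) ^ k\<close> times the lower bound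
    \<open>(1 - \<rho>) ^ k\<close> for \<open>prob_leading \<xi> k\<close>.\<close>
  define \<mu> where "\<mu> = (1 - \<rho>) / 2"
  define \<theta> where "\<theta> = \<rho> + \<mu>"
  have \<mu>: "0 < \<mu>" "\<mu> < 1" and \<theta>: "0 < \<theta>" "\<theta> < 1" using \<rho> by (auto simp: \<mu>_def \<theta>_def field_simps)
  \<comment> \<open>Solves \<open>\<mu> powr (\<beta> * k) = sqrt \<theta> ^ k\<close>: supports of
    size up to \<open>\<beta> * k\<close> use up only half of the exponential decay of
    \<open>\<theta> ^ k\<close>.\<close>
  define \<beta> where "\<beta> = ln \<theta> / (2 * ln \<mu>)"
  have \<beta>: "\<beta> > 0" using \<mu> \<theta> by (simp add: \<beta>_def divide_neg_neg)
  define M where "M = ln (\<mu>)"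
  define c0 where "c0 = C / sqrt \<beta>"
  \<comment> \<open>From \<open>F \<ge> k / 20\<close> comes
    \<open>F * sqrt F \<ge> k powr (3 / 2) / (20 * sqrt 20)\<close>; the remaining factor 2 accounts
    for the two signs.\<close>
  define c1 where "c1 = 40 * sqrt 20 * C"
  have c: "c0 > 0" "c1 > 0" using C0 \<beta> by (auto simp: c0_def c1_def)
  \<comment> \<open>The losses due to sparse vectors, to the last row and to structured vectors, in
    this order.\<close>
  define r where "r = (\<lambda>k. sqrt \<theta> ^ k + c1 * real k powr (- 11 / 10) + 2 * (1 / 2) ^ k)"
  have "summable r"
    unfolding r_def
    by (intro summable_add summable_mult summable_geometric)
       (use \<theta> in \<open>auto simp: summable_real_powr_iff\<close>)
  moreover have "0 \<le> r k" for k using \<theta> c by (simp add: r_def)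
  moreover have "eventually (\<lambda>k. prob_leading \<xi> (Suc k) \<ge> prob_leading \<xi> k * (1 - r k)) sequentially"
  proof -
    have "eventually (\<lambda>k. \<forall>D \<rho>. real D \<le> 2 * real k powr (7 / 20) \<longrightarrow> 0 \<le> \<rho> \<longrightarrow> \<rho> \<le> c0 * real k powr (- (1 / 2)) \<longrightarrow>
      (real D + 1) ^ Suc k * 2 ^ k * \<rho> ^ (k - (D + k div 10)) \<le> exp M ^ k) sequentially"
      by (rule eventually_superexponential[OF c(1) _ filterlim_stage1]) (simp, real_asymp)
    moreover have "eventually (\<lambda>k. \<forall>D \<rho>. real D \<le> 2 * real k powr (3 / 5) \<longrightarrow> 0 \<le> \<rho> \<longrightarrow> \<rho> \<le> c1 * real k powr (- (17 / 20)) \<longrightarrow>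
      (real D + 1) ^ Suc k * 2 ^ k * \<rho> ^ (k - (D + k div 10)) \<le> exp M ^ k) sequentially"
      by (rule eventually_superexponential[OF c(2) _ filterlim_stage2]) (simp, real_asymp)
    moreover have "eventually (\<lambda>k. c0 * real k powr (- (1 / 2)) \<le> 1) sequentially"
      using c(1) by real_asymp
    moreover have "eventually (\<lambda>k. c1 * real k powr (- (17 / 20)) \<le> 1) sequentially"
      using c(2) by real_asymp
    moreover have "eventually (\<lambda>k. 2 * real k powr (13 / 20) \<le> real k / 20) sequentially"
      by real_asymp
    moreover have "eventually (\<lambda>k. 2 * real k powr (2 / 5) \<le> real k / 20) sequentially"
      by real_asymp
    ultimately show ?thesis
      using eventually_ge_at_top[of 20]
    proof eventually_elim
      case (elim k)
      define F where "F = k div 10"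
      \<comment> \<open>The exponents \<open>13 / 20\<close> and \<open>2 / 5\<close> complement the
        label exponents \<open>7 / 20\<close> and \<open>3 / 5\<close>: values of multiplicity above
        \<open>k powr x\<close> number at most about \<open>k powr (1 - x)\<close>.\<close>
      define m1 where "m1 = nat \<lfloor>real k powr (13 / 20)\<rfloor>"
      define m2 where "m2 = nat \<lfloor>real k powr (2 / 5)\<rfloor>"
      define s where "s = \<beta> * real k"
      define S where "S = nat \<lfloor>s\<rfloor>"
      have k: "k \<ge> 20" by (rule elim(7))
      have k0: "real k > 0" using k by simp
      have s: "0 < s" using \<beta> k by (simp add: s_def)
      have sS: "s \<le> real c" if "S < c" for c :: nat using that unfolding S_def by linarith
      have floor: "real (nat \<lfloor>x\<rfloor>) \<le> x" "x \<le> real (Suc (nat \<lfloor>x\<rfloor>))" if "1 \<le> x" for x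
        using that by linarith+
      have p1: "1 \<le> real k powr (13 / 20)" "1 \<le> real k powr (2 / 5)" using k by (auto intro!: ge_one_powr_ge_zero)
      have m1: "real m1 \<le> real k powr (13 / 20)" "real k powr (13 / 20) \<le> real (Suc m1)" "0 < m1"
        using floor[OF p1(1)] p1(1) by (auto simp: m1_def)
      have m2: "real m2 \<le> real k powr (2 / 5)" "real k powr (2 / 5) \<le> real (Suc m2)" "0 < m2"
        using floor[OF p1(2)] p1(2) by (auto simp: m2_def)
      have F: "real k / 20 \<le> real F" using k unfolding F_def by linarith
      have m1F: "2 * m1 \<le> F" and m2F: "2 * m2 \<le> F" using elim(5,6) m1(1) m2(1) F by linarith+
      have frac: "C * (2 * real m) / (F * sqrt F) \<le> c1 * real k powr (x - 3 / 2)" if "real m \<le> real k powr x" for m :: nat and x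
      proof -
        have "real k * sqrt k = real k powr (3 / 2)"
          using k0 powr_add[of "real k" 1 "1 / 2"] by (simp add: powr_half_sqrt)
        then have "real k powr (3 / 2) / (20 * sqrt 20) = real k / 20 * sqrt (real k / 20)"
          by (simp add: real_sqrt_divide)
        also have "\<dots> \<le> F * sqrt F" using F by (intro mult_mono) auto
        finally have "C * (2 * real m) / (F * sqrt F) \<le> C * (2 * real k powr x) / (real k powr (3 / 2) / (20 * sqrt 20))"
          using that C0 k0 by (intro frac_le) auto
        also have "\<dots> = c1 * real k powr (x - 3 / 2)" by (simp add: c1_def powr_diff)
        finally show ?thesis by simp
      qed
      have \<rho>1: "C * (2 * real m1) / (F * sqrt F) \<le> c1 * real k powr (- (17 / 20))" using frac[OF m1(1)] by simp
      have q: "C * (2 * real m2) / (F * sqrt F) \<le> c1 * real k powr (- 11 / 10)" using frac[OF m2(1)] by simp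
      have \<rho>0: "C / sqrt s \<le> c0 * real k powr (- (1 / 2))"
      proof -
        have "real k powr (- (1 / 2)) = 1 / sqrt k"
          using k0 by (simp only: powr_minus_divide) (simp add: powr_half_sqrt)
        then show ?thesis by (simp only: s_def c0_def real_sqrt_mult) simp
      qed
      have D: "real (Suc k div Suc m) \<le> 2 * real k powr (1 - x)" if "real k powr x \<le> real (Suc m)" for m x
      proof -
        have "real (Suc k div Suc m) \<le> real (Suc k) / real (Suc m)" by (rule of_nat_div_le_of_nat)
        also have "\<dots> \<le> (2 * real k) / real k powr x" using that k by (intro frac_le) auto
        also have "\<dots> = 2 * real k powr (1 - x)" using k0 by (simp add: powr_diff)
        finally show ?thesis .
      qed
      have D1: "real (Suc k div Suc m1) \<le> 2 * real k powr (7 / 20)" using D[OF m1(2)] by simp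
      have D2: "real (Suc k div Suc m2) \<le> 2 * real k powr (3 / 5)" using D[OF m2(2)] by simp
      define sparse where "sparse = (\<lambda>v :: nat \<Rightarrow> real. card {j. j < k \<and> v j \<noteq> 0} \<le> S)"
      define structured where "structured = (\<lambda>v :: nat \<Rightarrow> real.
        S < card {j. j < k \<and> v j \<noteq> 0} \<and> card (rare_coords (Suc k) m1 v) \<le> F
        \<or> F < card (rare_coords (Suc k) m1 v) \<and> card (rare_coords (Suc k) m2 v) \<le> F)"
      have "measure_pmf.prob (iid \<xi> ({..<k} \<times> {..<Suc k})) {f. \<exists>v. null_vector k f v \<and> structured v}
          \<le> (real (Suc k div Suc m1) + 1) ^ Suc k * 2 ^ k * (C / sqrt s) ^ (k - (Suc k div Suc m1 + F))
          + (real (Suc k div Suc m2) + 1) ^ Suc k * 2 ^ k * (C * (2 * real m1) / (F * sqrt F)) ^ (k - (Suc k div Suc m2 + F))"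
        unfolding structured_def using \<rho>0 \<rho>1 elim(3,4)
        by (intro prob_structured_le[OF C s sS m1(3) m1F]) linarith+
      also have "\<dots> \<le> exp M ^ k + exp M ^ k"
        unfolding F_def
        using elim(1)[rule_format, OF D1 _ \<rho>0] elim(2)[rule_format, OF D2 _ \<rho>1] C0 s
        by (intro add_mono) (auto simp: F_def)
      also have "\<dots> = 2 * \<mu> ^ k" using \<mu> by (simp add: M_def)
      finally have st: "measure_pmf.prob (iid \<xi> ({..<k} \<times> {..<Suc k})) {f. \<exists>v. null_vector k f v \<and> structured v} \<le> 2 * \<mu> ^ k" .
      have sp: "measure_pmf.prob (iid \<xi> ({..<k} \<times> {..<Suc k})) {f. leading_nonzero k f \<and> (\<exists>v. null_vector k f v \<and> sparse v)}
          \<le> prob_leading \<xi> k * (\<theta> ^ k / \<mu> ^ S)"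
      proof -
        have "measure_pmf.prob (iid \<xi> ({..<k} \<times> {..<Suc k}))
            {f. leading_nonzero k f \<and> (\<exists>v. v k = 1 \<and> card {j. j < k \<and> v j \<noteq> 0} \<le> S \<and> (\<forall>i<k. (\<Sum>j<Suc k. f (i, j) * v j) = 0))}
          \<le> measure_pmf.prob (iid \<xi> ({..<k} \<times> {..<k})) {f. leading_nonzero k f} * ((\<rho> + \<mu>) ^ k / \<mu> ^ S)"
          using \<rho> \<mu> max_atom_ge[of \<xi>]
          by (intro prob_sparse_combination_le) (auto simp: \<rho>_def intro!: leading_nonzero_cong)
        moreover have "{f. leading_nonzero k f \<and> (\<exists>v. null_vector k f v \<and> sparse v)}
          = {f. leading_nonzero k f \<and> (\<exists>v. v k = 1 \<and> card {j. j < k \<and> v j \<noteq> 0} \<le> S \<and> (\<forall>i<k. (\<Sum>j<Suc k. f (i, j) * v j) = 0))}"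
          unfolding null_vector_def sparse_def by blast
        ultimately show ?thesis by (simp only: \<theta>_def prob_leading_def)
      qed
      have e: "\<theta> ^ k / \<mu> ^ S \<le> sqrt \<theta> ^ k"
      proof -
        have "sqrt \<theta> ^ k = \<mu> powr s"
        proof -
          have eq: "s * ln \<mu> = real k * (ln \<theta> / 2)" using \<mu> by (simp add: s_def \<beta>_def)
          have "\<mu> powr s = exp (s * ln \<mu>)" using \<mu> by (simp add: powr_def)
          also have "\<dots> = exp (ln \<theta> / 2) ^ k" unfolding eq by (rule exp_of_nat_mult)
          also have "exp (ln \<theta> / 2) = sqrt \<theta>" using \<theta> by (simp add: powr_half_sqrt [symmetric] powr_def)
          finally show ?thesis by simp
        qed
        also have "\<dots> \<le> \<mu> powr real S" using \<mu> s by (intro powr_mono') (auto simp: S_def)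
        also have "\<dots> = \<mu> ^ S" using \<mu> by (simp add: powr_realpow)
        finally have "sqrt \<theta> ^ k \<le> \<mu> ^ S" .
        then have "\<theta> ^ k / \<mu> ^ S \<le> \<theta> ^ k / sqrt \<theta> ^ k"
          using \<theta> \<mu> by (intro divide_left_mono) auto
        also have "\<dots> = sqrt \<theta> ^ k"
          using \<theta> by (simp add: power_divide [symmetric] real_div_sqrt)
        finally show ?thesis .
      qed
      have row: "measure_pmf.prob (iid \<xi> ({k} \<times> {..<Suc k})) {f. (\<Sum>j<Suc k. f (k, j) * v j) = 0} \<le> C * (2 * real m2) / (F * sqrt F)"
        if "\<not> sparse v" "\<not> structured v" for v
        using that by (intro prob_row_le_rare[OF C m2(3) m2F]) (auto simp: sparse_def structured_def)
      have g0: "prob_leading \<xi> k \<ge> 0" by (simp add: prob_leading_def)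
      have "2 * \<mu> ^ k \<le> 2 * (1 / 2) ^ k * prob_leading \<xi> k"
        using prob_leading_ge_power[of \<xi> k] \<xi> by (simp add: \<mu>_def \<rho>_def power_divide divide_right_mono)
      then have "prob_leading \<xi> k * (1 - r k)
          \<le> prob_leading \<xi> k * (1 - \<theta> ^ k / \<mu> ^ S - C * (2 * real m2) / (F * sqrt F)) - 2 * \<mu> ^ k"
      proof -
        have "prob_leading \<xi> k * (1 - r k) = prob_leading \<xi> k * (1 - sqrt \<theta> ^ k - c1 * real k powr (- 11 / 10)) - 2 * (1 / 2) ^ k * prob_leading \<xi> k"
          by (simp add: r_def algebra_simps)
        also have "\<dots> \<le> prob_leading \<xi> k * (1 - \<theta> ^ k / \<mu> ^ S - C * (2 * real m2) / (F * sqrt F)) - 2 * \<mu> ^ k"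
          using g0 e q \<open>2 * \<mu> ^ k \<le> _\<close> by (intro diff_mono mult_left_mono) auto
        finally show ?thesis .
      qed
      also have "\<dots> \<le> prob_leading \<xi> (Suc k)"
        using C0 by (intro prob_leading_Suc_ge[OF _ sp st] row) auto
      finally show ?case .
    qed
  qed
  ultimately show ?thesis by blast
qed

theorem corollary1p2:
  fixes \<xi> :: "real pmf"
  assumes "finite (set_pmf \<xi>)"
    and "max_atom \<xi> < 1"
  shows "\<exists>C>0. \<forall>n\<ge>1.
    measure_pmf.prob (random_matrix n \<xi>) {A. strongly_nonsingular A} \<ge> C"
proof -
  obtain C where "concentration_const \<xi> C" using concentration_const_exists[OF assms] by blast
  then obtain r where r: "\<And>k. 0 \<le> r k" "summable r"
    "eventually (\<lambda>k. prob_leading \<xi> (Suc k) \<ge> prob_leading \<xi> k * (1 - r k)) sequentially"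
    using prob_leading_step[OF _ assms(2)] by blast
  have "\<exists>C>0. \<forall>n. prob_leading \<xi> n \<ge> C"
    using assms(2) r prob_leading_ge_power[of \<xi>] max_atom_nonneg[of \<xi>]
    by (intro bounded_below_of_summable_loss[where r = r and \<kappa> = "1 - max_atom \<xi>"]) auto
  then show ?thesis by (auto simp: prob_random_matrix)
qed

end
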